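(* Call a partition of an even positive integer $n$ graphical if its parts form the degree sequence of a simple graph (no loops or multiple edges). Then the probability that a uniformly random partition of an even integer $n$ is graphical is $$O\left(\frac{1}{\ln^{1/2}n}\right)\qquad (n\to\infty).$$ *)

theory Defs
  imports "HOL-Probability.Probability" "HOL-Library.Landau_Symbols" "HOL-Library.Multiset"
begin

definition partitions :: "nat \<Rightarrow> nat multiset set" where
  "partitions n = {p. (\<forall>k\<in>#p. 0 < k) \<and> \<Sum>\<^sub># p = n}"

text \<open>Edges are two-element sets of vertices, so loops and multiple edges are excluded.\<close>

definition simple_graph :: "'v set \<Rightarrow> 'v set set \<Rightarrow> bool" where
  "simple_graph V E \<longleftrightarrow> finite V \<and> (\<forall>e\<in>E. e \<subseteq> V \<and> card e = 2)"

definition degree :: "'v set set \<Rightarrow> 'v \<Rightarrow> nat" where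
  "degree E v = card {e \<in> E. v \<in> e}"

definition degree_sequence :: "'v set \<Rightarrow> 'v set set \<Rightarrow> nat multiset" where
  "degree_sequence V E = image_mset (degree E) (mset_set V)"

text \<open>Taking the vertices from the natural numbers is no restriction, since every finite
  graph is isomorphic to one with such vertices.\<close>

definition graphical :: "nat multiset \<Rightarrow> bool" where
  "graphical p \<longleftrightarrow> (\<exists>(V :: nat set) E. simple_graph V E \<and> degree_sequence V E = p)"

text \<open>The uniform distribution \<open>pmf_of_set (partitions n)\<close> is meaningful only because
  of the next two facts.\<close>

lemma finite_partitions: "finite (partitions n)"
proof (rule finite_subset)
  show "partitions n \<subseteq> mset ` {xs. set xs \<subseteq> {..n} \<and> length xs \<le> n}"
  proof
    fix p assume p: "p \<in> partitions n"
    obtain xs where xs: "p = mset xs" by (metis ex_mset)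
    have pos: "\<forall>k\<in>set xs. 0 < k" and s: "sum_list xs = n"
      using p by (auto simp: partitions_def xs sum_mset_sum_list)
    have "length xs \<le> sum_list xs"
      using pos by (induction xs) (auto simp: Suc_le_eq)
    moreover have "set xs \<subseteq> {..n}"
      using s member_le_sum_list by fastforce
    ultimately show "p \<in> mset ` {xs. set xs \<subseteq> {..n} \<and> length xs \<le> n}"
      using s xs by auto
  qed
  show "finite (mset ` {xs. set xs \<subseteq> {..n} \<and> length xs \<le> n})"
    by (intro finite_imageI finite_lists_length_le) simp
qed

lemma partitions_nonempty: "partitions n \<noteq> {}"
proof -
  have "replicate_mset n 1 \<in> partitions n"
    by (auto simp: partitions_def)
  then show ?thesis by blast
qed

end

theory Submission
  imports Defs "HOL-Real_Asymp.Real_Asymp"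
begin

text \<open>
  Cut a Young diagram along its Durfee square, of side \<open>D\<close>. Let \<open>a\<^sub>j\<close> be the number of columns
  of height \<open>j\<close> to the right of the square and \<open>b\<^sub>j\<close> the number of rows of length \<open>j\<close> below it.
  The easy direction of the Erdos--Gallai theorem says that a graphical partition satisfies
  \<open>(\<Sum>j. min j k * (b\<^sub>j - a\<^sub>j)) \<ge> 0\<close> for all \<open>k \<le> D\<close>. Given \<open>D\<close> and the sums
  \<open>s\<^sub>j = a\<^sub>j + b\<^sub>j\<close>, the \<open>a\<^sub>j\<close> are independent and uniform on \<open>{0..s\<^sub>j}\<close>, so the differences are
  independent and centred. Typically \<open>j * s\<^sub>j\<close> has order \<open>sqrt n\<close>, hence the sum for \<open>k\<close> is
  governed by the \<open>j\<close> close to \<open>k\<close>. Choosing about \<open>20 * ln (ln n)\<close> values of \<open>k\<close> that are separated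
  by powers of \<open>ln n\<close>, the sums are nearly independent, and each is negative with
  probability bounded away from 0.

  The typical size of \<open>s\<^sub>j\<close> comes from counting. Since the parts sum to \<open>n\<close>, removing \<open>4 * sqrt n\<close>
  from \<open>n\<close> divides the number of partitions by at least 3, which bounds the second moment of the
  multiplicities. In the other direction, turning one part of a partition without ones into ones is
  injective, and almost all partitions have many distinct parts, so few partitions have
  no ones; this makes small multiplicities unlikely.
\<close>

section \<open>Multiplicities in random partitions\<close>

lemma replicate_mset_subseteq_of_count:
  assumes "r \<le> count \<pi> j"
  shows "replicate_mset r j \<subseteq># \<pi>"
  using assms by (simp add: count_le_replicate_mset_subset_eq)

text \<open>Adding \<open>r\<close> copies of \<open>j\<close> to a partition of
  \<open>n - r * j\<close> is undone by removing them.\<close>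

lemma card_partitions_count_ge:
  assumes "0 < j" "r * j \<le> n"
  shows "card {\<pi> \<in> partitions n. r \<le> count \<pi> j} = card (partitions (n - r * j))"
proof -
  have "bij_betw (\<lambda>\<mu>. \<mu> + replicate_mset r j) (partitions (n - r * j))
          {\<pi> \<in> partitions n. r \<le> count \<pi> j}"
  proof (rule bij_betw_byWitness[where f' = "\<lambda>\<mu>. \<mu> - replicate_mset r j"])
    show "\<forall>a\<in>{\<pi> \<in> partitions n. r \<le> count \<pi> j}. a - replicate_mset r j + replicate_mset r j = a"
      by (auto simp: replicate_mset_subseteq_of_count subset_mset.diff_add)
    show "(\<lambda>\<mu>. \<mu> + replicate_mset r j) ` partitions (n - r * j) \<subseteq> {\<pi> \<in> partitions n. r \<le> count \<pi> j}"
      using assms by (auto simp: partitions_def split: if_splits)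
    show "(\<lambda>\<mu>. \<mu> - replicate_mset r j) ` {\<pi> \<in> partitions n. r \<le> count \<pi> j} \<subseteq> partitions (n - r * j)"
    proof
      fix \<mu> assume "\<mu> \<in> (\<lambda>\<mu>. \<mu> - replicate_mset r j) ` {\<pi> \<in> partitions n. r \<le> count \<pi> j}"
      then obtain \<pi> where l: "\<pi> \<in> partitions n" "r \<le> count \<pi> j" "\<mu> = \<pi> - replicate_mset r j" by auto
      then have "\<pi> = \<mu> + replicate_mset r j" by (simp add: replicate_mset_subseteq_of_count subset_mset.diff_add)
      then show "\<mu> \<in> partitions (n - r * j)" using l(1) by (auto simp: partitions_def)
    qed
  qed auto
  then show ?thesis by (simp add: bij_betw_same_card)
qed

lemma sum_mult_count_le:
  assumes "finite A"
  shows "(\<Sum>j\<in>A. j * count \<pi> j) \<le> \<Sum>\<^sub># \<pi>"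
proof (induction \<pi>)
  case (add x \<pi>)
  have "(\<Sum>j\<in>A. j * count (add_mset x \<pi>) j) = (\<Sum>j\<in>A. j * count \<pi> j + (if j = x then x else 0))"
    by (intro sum.cong) auto
  also have "\<dots> \<le> (\<Sum>j\<in>A. j * count \<pi> j) + x"
    using assms by (simp add: sum.distrib)
  finally show ?case using add by simp
qed simp

lemma partitions_count_mult_le:
  assumes "\<pi> \<in> partitions n" "finite A"
  shows "(\<Sum>j\<in>A. j * count \<pi> j) \<le> n"
  using sum_mult_count_le[OF assms(2), of \<pi>] assms(1) by (simp add: partitions_def)

lemma partitions_count_ge_empty:
  assumes "n < r * j"
  shows "{\<pi> \<in> partitions n. r \<le> count \<pi> j} = {}"
proof -
  have "r * j \<le> n" if "\<pi> \<in> partitions n" "r \<le> count \<pi> j" for \<pi>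
    by (metis le_trans mult.commute mult_le_mono2 partitions_count_mult_le[OF that(1), of "{j}", simplified] that(2))
  then show ?thesis using assms by fastforce
qed

text \<open>Padding with \<open>n - m\<close> ones turns partitions of \<open>m\<close> into
  partitions of \<open>n\<close>.\<close>

lemma card_partitions_mono: "m \<le> n \<Longrightarrow> card (partitions m) \<le> card (partitions n)"
  using card_partitions_count_ge[of 1 "n - m" n] card_mono[OF finite_partitions, of "{\<pi> \<in> partitions n. n - m \<le> count \<pi> 1}" n]
  by auto

lemma card_partitions_pos: "0 < card (partitions n)"
  using finite_partitions partitions_nonempty by (simp add: card_gt_0_iff)

text \<open>Double counting of the sum of \<open>j * count \<pi> j\<close> over all partitions and
  all \<open>j \<le> J\<close>. Each partition contributes at most \<open>n \<le> J\<^sup>2\<close>.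
  Each \<open>j\<close> contributes at least \<open>3 * J * card (partitions (n - 4 * J))\<close>,
  through the partitions with at least \<open>4 * J div j\<close> copies of
  \<open>j\<close>.\<close>

lemma card_partitions_diff_three:
  assumes "n \<le> J\<^sup>2" "4 * J \<le> n" "0 < J"
  shows "3 * card (partitions (n - 4 * J)) \<le> card (partitions n)"
proof -
  let ?p = "\<lambda>n. card (partitions n)"
  have each: "(4 * J - j) * ?p (n - 4 * J) \<le> (\<Sum>\<pi>\<in>partitions n. j * count \<pi> j)"
    if j: "j \<in> {1..J}" for j
  proof -
    define r where "r = 4 * J div j"
    have rj: "r * j \<le> 4 * J" "4 * J - j \<le> j * r"
      using j mult_div_mod_eq[of j "4 * J"] mod_less_divisor[of j "4 * J"] unfolding r_def
      by (simp_all only: mult.commute[of _ j] atLeastAtMost_iff) linarith+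
    have "(4 * J - j) * ?p (n - 4 * J) \<le> (j * r) * ?p (n - r * j)"
      using rj assms by (intro mult_le_mono card_partitions_mono) auto
    also have "\<dots> = (\<Sum>\<pi>\<in>{\<pi>\<in>partitions n. r \<le> count \<pi> j}. j * r)"
      using card_partitions_count_ge[of j r n] j rj assms by simp
    also have "\<dots> \<le> (\<Sum>\<pi>\<in>{\<pi>\<in>partitions n. r \<le> count \<pi> j}. j * count \<pi> j)"
      by (intro sum_mono) auto
    also have "\<dots> \<le> (\<Sum>\<pi>\<in>partitions n. j * count \<pi> j)"
      by (intro sum_mono2 finite_partitions) auto
    finally show ?thesis .
  qed
  have "3 * J\<^sup>2 * ?p (n - 4 * J) = (\<Sum>j\<in>{1..J}. 3 * J * ?p (n - 4 * J))"
    by (simp add: power2_eq_square)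
  also have "\<dots> \<le> (\<Sum>j\<in>{1..J}. (4 * J - j) * ?p (n - 4 * J))"
    by (intro sum_mono mult_le_mono) auto
  also have "\<dots> \<le> (\<Sum>j\<in>{1..J}. \<Sum>\<pi>\<in>partitions n. j * count \<pi> j)"
    by (intro sum_mono each)
  also have "\<dots> = (\<Sum>\<pi>\<in>partitions n. \<Sum>j\<in>{1..J}. j * count \<pi> j)"
    by (rule sum.swap)
  also have "\<dots> \<le> (\<Sum>\<pi>\<in>partitions n. n)"
    by (intro sum_mono partitions_count_mult_le) auto
  also have "\<dots> \<le> J\<^sup>2 * ?p n" using assms by simp
  finally have "J\<^sup>2 * (3 * ?p (n - 4 * J)) \<le> J\<^sup>2 * ?p n" by (simp add: ac_simps)
  then show ?thesis using assms(3) by simp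
qed

lemma card_partitions_diff_power_three:
  assumes "n \<le> J\<^sup>2" "0 < J" "4 * J * t \<le> n"
  shows "3 ^ t * card (partitions (n - 4 * J * t)) \<le> card (partitions n)"
  using assms(3)
proof (induction t)
  case (Suc t)
  have "3 * card (partitions (n - 4 * J * t - 4 * J)) \<le> card (partitions (n - 4 * J * t))"
    using assms(1,2) Suc.prems by (intro card_partitions_diff_three) auto
  moreover have "n - 4 * J * Suc t = n - 4 * J * t - 4 * J" by simp
  ultimately have "3 ^ Suc t * card (partitions (n - 4 * J * Suc t)) \<le> 3 ^ t * card (partitions (n - 4 * J * t))"
    by simp
  also have "\<dots> \<le> card (partitions n)" using Suc by simp
  finally show ?case .
qed simp

text \<open>The weights \<open>2 * t + 1\<close> are the increments of the squares, so this sum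
  turns geometric tails into a second moment. All its values are below 3.\<close>

lemma sum_odd_third_powers: "(\<Sum>t\<le>q. (2 * real t + 1) / 3 ^ t) = 3 - (real q + 2) / 3 ^ q"
  by (induction q) (auto simp: field_simps)

lemma sum_odds: "(\<Sum>t\<le>q. 2 * t + 1) = (q + 1)\<^sup>2" for q :: nat
  by (induction q) (auto simp: power2_eq_square)

text \<open>In units of \<open>4 * J\<close>, the quantity \<open>j * count \<pi> j\<close> has
  geometric tails: it reaches \<open>t\<close> units for at most a share \<open>1 / 3 ^ t\<close> of
  the partitions. The constant is 48 = 16 * 3, from the squared unit and the bound 3 on the weighted
  sum of tails.\<close>

lemma partitions_count_second_moment:
  assumes "n \<le> J\<^sup>2" "0 < J" "0 < j"
  shows "(\<Sum>\<pi>\<in>partitions n. (real j * real (count \<pi> j))\<^sup>2) \<le> 48 * real J ^ 2 * card (partitions n)"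
proof -
  let ?p = "\<lambda>n. real (card (partitions n))"
  define q where "q = (\<lambda>\<pi>. j * count \<pi> j div (4 * J))"
  have qn: "q \<pi> \<le> n" if "\<pi> \<in> partitions n" for \<pi>
    using partitions_count_mult_le[OF that, of "{j}"] unfolding q_def
    by (auto intro: le_trans[OF div_le_dividend])
  have tail: "real (card {\<pi>\<in>partitions n. t \<le> q \<pi>}) \<le> ?p n / 3 ^ t" for t
  proof (cases "4 * J * t \<le> n")
    case False
    have "t > q \<pi>" if "\<pi> \<in> partitions n" for \<pi>
    proof -
      have "j * count \<pi> j < t * (4 * J)" using partitions_count_mult_le[OF that, of "{j}"] False by (simp add: ac_simps)
      then show ?thesis unfolding q_def using assms(2) by (simp add: div_less_iff_less_mult)
    qed
    then have "{\<pi>\<in>partitions n. t \<le> q \<pi>} = {}" by fastforce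
    then show ?thesis by (simp only: card.empty) simp
  next
    case True
    \<comment> \<open>This is \<open>4 * J * t / j\<close> rounded up: removing \<open>r\<close>
      copies of \<open>j\<close> takes away at least \<open>4 * J * t\<close>, and \<open>r\<close>
      copies are present as soon as \<open>t \<le> q \<pi>\<close>.\<close>
    define r where "r = (4 * J * t + (j - 1)) div j"
    have r1: "4 * J * t \<le> r * j"
    proof -
      have "(4 * J * t + (j - 1)) mod j \<le> j - 1" using mod_less_divisor[OF assms(3), of "4 * J * t + (j - 1)"] by linarith
      then show ?thesis using div_mult_mod_eq[of "4 * J * t + (j - 1)" j] unfolding r_def by linarith
    qed
    have sub: "{\<pi>\<in>partitions n. t \<le> q \<pi>} \<subseteq> {\<pi>\<in>partitions n. r \<le> count \<pi> j}"
    proof safe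
      fix \<pi> assume "t \<le> q \<pi>"
      then have "4 * J * t \<le> j * count \<pi> j" unfolding q_def using assms(2)
        by (simp add: less_eq_div_iff_mult_less_eq ac_simps)
      then have "4 * J * t + (j - 1) < j * Suc (count \<pi> j)" using assms(3) by simp
      then show "r \<le> count \<pi> j" unfolding r_def using assms(3)
        by (metis less_Suc_eq_le div_less_iff_less_mult mult.commute)
    qed
    have "card {\<pi>\<in>partitions n. t \<le> q \<pi>} \<le> card {\<pi>\<in>partitions n. r \<le> count \<pi> j}"
      using sub by (intro card_mono) (auto simp: finite_partitions)
    also have "\<dots> \<le> card (partitions (n - 4 * J * t))"
    proof (cases "r * j \<le> n")
      case True
      then show ?thesis using card_partitions_count_ge[OF assms(3) True] r1
        by (simp add: card_partitions_mono)
    next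
      case False
      then show ?thesis using partitions_count_ge_empty[of n r j] by (simp only: not_le card.empty)
    qed
    finally have "3 ^ t * card {\<pi>\<in>partitions n. t \<le> q \<pi>} \<le> card (partitions n)"
      using card_partitions_diff_power_three[OF assms(1,2) True]
      by (meson le_trans mult_le_mono2)
    then have "real (3 ^ t * card {\<pi>\<in>partitions n. t \<le> q \<pi>}) \<le> ?p n" by linarith
    then show ?thesis by (simp add: field_simps)
  qed
  \<comment> \<open>As \<open>q\<close> is rounded down, the square is bounded with one more unit.
    Writing \<open>(q \<pi> + 1)\<^sup>2\<close> as a sum of odd numbers over
    \<open>t \<le> q \<pi>\<close> brings in the tail events.\<close>
  have pt: "(real j * real (count \<pi> j))\<^sup>2 \<le> 16 * real J ^ 2 * (\<Sum>t\<le>n. (2 * real t + 1) * of_bool (t \<le> q \<pi>))"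
    if l: "\<pi> \<in> partitions n" for \<pi>
  proof -
    have "j * count \<pi> j < 4 * J * (q \<pi> + 1)"
      unfolding q_def using assms(2) dividend_less_div_times[of "4*J" "j * count \<pi> j"] by (simp add: algebra_simps)
    then have "real j * real (count \<pi> j) \<le> 4 * J * (real (q \<pi>) + 1)"
      by (metis (mono_tags) less_imp_le of_nat_1 of_nat_add of_nat_le_iff of_nat_mult)
    then have "(real j * real (count \<pi> j))\<^sup>2 \<le> (4 * J * (real (q \<pi>) + 1))\<^sup>2"
      by (intro power_mono) auto
    also have "\<dots> = 16 * real J ^ 2 * real ((q \<pi> + 1)\<^sup>2)" by (simp add: power_mult_distrib)
    also have "real ((q \<pi> + 1)\<^sup>2) = (\<Sum>t\<le>q \<pi>. 2 * real t + 1)"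
      unfolding sum_odds[symmetric] by (simp add: add.commute)
    also have "\<dots> = (\<Sum>t\<le>n. (2 * real t + 1) * of_bool (t \<le> q \<pi>))"
      using qn[OF l] by (intro sum.mono_neutral_cong_left) auto
    finally show ?thesis .
  qed
  have "(\<Sum>\<pi>\<in>partitions n. (real j * real (count \<pi> j))\<^sup>2)
      \<le> (\<Sum>\<pi>\<in>partitions n. 16 * real J ^ 2 * (\<Sum>t\<le>n. (2 * real t + 1) * of_bool (t \<le> q \<pi>)))"
    by (intro sum_mono pt)
  also have "\<dots> = 16 * real J ^ 2 * (\<Sum>t\<le>n. (2 * real t + 1) * (\<Sum>\<pi>\<in>partitions n. of_bool (t \<le> q \<pi>)))"
    by (subst sum_distrib_left[symmetric], subst sum.swap) (simp add: sum_distrib_left)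
  also have "\<dots> \<le> 16 * real J ^ 2 * (\<Sum>t\<le>n. (2 * real t + 1) * (?p n / 3 ^ t))"
  proof (intro mult_left_mono sum_mono)
    fix t
    have "(\<Sum>\<pi>\<in>partitions n. of_bool (t \<le> q \<pi>)) = real (card {\<pi>\<in>partitions n. t \<le> q \<pi>})"
      by (simp add: finite_partitions Int_def)
    then show "(\<Sum>\<pi>\<in>partitions n. of_bool (t \<le> q \<pi>)) \<le> ?p n / 3 ^ t" using tail[of t] by simp
  qed auto
  also have "(\<Sum>t\<le>n. (2 * real t + 1) * (?p n / 3 ^ t)) = ?p n * (\<Sum>t\<le>n. (2 * real t + 1) / 3 ^ t)"
    by (simp add: sum_distrib_left mult.commute)
  also have "16 * real J ^ 2 * \<dots> \<le> 16 * real J ^ 2 * (?p n * 3)"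
    unfolding sum_odd_third_powers by (intro mult_left_mono) auto
  finally show ?thesis by simp
qed

text \<open>Every subset of \<open>{2..m}\<close> becomes a partition of \<open>n\<close> when
  padded with ones, and is recovered as the set of parts other than 1. There is room for this
  because the elements of \<open>{2..m}\<close> add up to at most \<open>m\<^sup>2\<close>.\<close>

lemma card_partitions_ge_power_two:
  assumes "m\<^sup>2 \<le> n" "0 < m"
  shows "2 ^ (m - 1) \<le> card (partitions n)"
proof -
  define f where "f = (\<lambda>S. mset_set S + replicate_mset (n - \<Sum>S) (1::nat))"
  have sumle: "\<Sum>S \<le> n" if "S \<subseteq> {2..m}" for S
  proof -
    have "\<Sum>S \<le> \<Sum>{2..m}" using that by (intro sum_mono2) auto
    also have "\<dots> \<le> (\<Sum>i\<in>{2..m}. m)" by (intro sum_mono) auto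
    also have "\<dots> \<le> m\<^sup>2" by (simp add: power2_eq_square)
    finally show ?thesis using assms(1) by simp
  qed
  have "inj_on f (Pow {2..m})"
  proof (rule inj_onI)
    fix S T assume S: "S \<in> Pow {2..m}" and T: "T \<in> Pow {2..m}" and eq: "f S = f T"
    have "finite S" "finite T" using S T by (auto dest: finite_subset)
    then have "set_mset (f S) - {1} = S" "set_mset (f T) - {1} = T"
      using S T unfolding f_def by (auto split: if_splits)
    with eq show "S = T" by metis
  qed
  moreover have "f ` Pow {2..m} \<subseteq> partitions n"
  proof
    fix p assume "p \<in> f ` Pow {2..m}"
    then obtain S where S: "S \<subseteq> {2..m}" "p = f S" by auto
    have "finite S" using S finite_subset by blast
    then show "p \<in> partitions n" using S sumle[OF S(1)]
      unfolding partitions_def f_def by (fastforce simp: sum_unfold_sum_mset split: if_splits)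
  qed
  ultimately have "card (Pow {2..m}) \<le> card (partitions n)"
    by (meson card_inj_on_le finite_partitions)
  then show ?thesis by (simp add: card_Pow)
qed

text \<open>A partition is determined by its set of pairs (part, multiplicity), here at most
  \<open>d\<close> points of \<open>{1..n} \<times> {1..n}\<close>. Such sets are covered by the
  lists of length \<open>d\<close>.\<close>

lemma card_partitions_few_distinct:
  assumes "0 < n"
  shows "card {\<pi> \<in> partitions n. card (set_mset \<pi>) \<le> d} \<le> (n\<^sup>2) ^ d"
proof -
  let ?A = "{\<pi> \<in> partitions n. card (set_mset \<pi>) \<le> d}"
  let ?X = "{1..n} \<times> {1..n}"
  let ?L = "{xs. set xs \<subseteq> ?X \<and> length xs = d}"
  define g where "g = (\<lambda>\<pi>. (\<lambda>j. (j, count \<pi> j)) ` set_mset (\<pi> :: nat multiset))"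
  have inj: "inj_on g ?A"
  proof (rule inj_onI, rule multiset_eqI)
    fix \<pi> \<mu> j assume eq: "g \<pi> = g \<mu>"
    have char: "(j, c) \<in> g \<nu> \<longleftrightarrow> c = count \<nu> j \<and> 0 < c" for c \<nu> unfolding g_def by auto
    show "count \<pi> j = count \<mu> j"
      using eq char[of _ \<pi>] char[of _ \<mu>] by (metis gr0I)
  qed
  have sub: "g ` ?A \<subseteq> set ` ?L"
  proof
    fix Y assume "Y \<in> g ` ?A"
    then obtain \<pi> where l: "\<pi> \<in> partitions n" "card (set_mset \<pi>) \<le> d" "Y = g \<pi>" by auto
    have Y: "Y \<subseteq> ?X"
    proof
      fix y assume "y \<in> Y"
      then obtain j where j: "j \<in># \<pi>" "y = (j, count \<pi> j)" using l(3) by (auto simp: g_def)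
      have "j * count \<pi> j \<le> n" using partitions_count_mult_le[OF l(1), of "{j}"] by simp
      moreover have "0 < j" "0 < count \<pi> j" using j l(1) by (auto simp: partitions_def)
      ultimately have "j \<le> n" "count \<pi> j \<le> n"
        by (metis (full_types) One_nat_def Suc_leI le_trans mult.right_neutral mult_le_mono2)
           (metis \<open>0 < j\<close> \<open>j * count \<pi> j \<le> n\<close> le_trans mult_le_mono1 One_nat_def Suc_leI mult_1)
      then show "y \<in> ?X" using j \<open>0 < j\<close> \<open>0 < count \<pi> j\<close> by auto
    qed
    have finY: "finite Y" and cardY: "card Y \<le> d" using l unfolding g_def
      by (auto intro: le_trans[OF card_image_le])
    \<comment> \<open>Shorter lists are filled up to length \<open>d\<close> by repeating one pair,
      which exists because \<open>n\<close> is positive.\<close>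
    have "\<pi> \<noteq> {#}" using l(1) assms by (auto simp: partitions_def)
    then obtain y where y: "y \<in> Y" using l(3) unfolding g_def by fastforce
    obtain ys where ys: "set ys = Y" "distinct ys" using finite_distinct_list[OF finY] by auto
    have "length ys \<le> d" using cardY ys distinct_card by metis
    then have "set (ys @ replicate (d - length ys) y) = Y" "length (ys @ replicate (d - length ys) y) = d"
      using ys y by auto
    then show "Y \<in> set ` ?L" using Y by (metis (mono_tags, lifting) image_eqI mem_Collect_eq)
  qed
  have finL: "finite ?L" by (intro finite_lists_length_eq) auto
  have "card ?A \<le> card (set ` ?L)"
    using card_inj_on_le[OF inj sub] finL by blast
  also have "\<dots> \<le> card ?L" using finL by (rule card_image_le)
  also have "\<dots> = card ?X ^ d" by (rule card_lists_length_eq) auto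
  finally show ?thesis by (simp add: power2_eq_square)
qed

text \<open>The part \<open>v\<close> that is turned into ones can be recovered as the number of ones.\<close>

lemma card_partitions_no_ones:
  "(d + 1) * card {\<pi> \<in> partitions n. count \<pi> 1 = 0}
     \<le> card (partitions n) + (d + 1) * card {\<pi> \<in> partitions n. card (set_mset \<pi>) \<le> d}"
proof -
  let ?A = "{\<pi> \<in> partitions n. count \<pi> 1 = 0}"
  let ?B = "{\<pi> \<in> partitions n. card (set_mset \<pi>) \<le> d}"
  have fin: "finite ?A" "finite ?B" using finite_partitions by auto
  define f where "f = (\<lambda>(\<pi>, v). \<pi> - {#v#} + replicate_mset v (1::nat))"
  have inj: "inj_on f (Sigma ?A set_mset)"
  proof (rule inj_onI, clarify)
    fix \<pi> v \<mu> w
    assume a: "count \<pi> 1 = 0" "v \<in># \<pi>" "count \<mu> 1 = 0" "w \<in># \<mu>" "f (\<pi>, v) = f (\<mu>, w)"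
    have "count (f (\<pi>, v)) 1 = v" if "v \<in># \<pi>" "count \<pi> 1 = 0" for \<pi> v
      using that unfolding f_def by (cases "v = 1") (auto simp: count_eq_zero_iff)
    then have "count (f (\<pi>, v)) 1 = v" "count (f (\<mu>, w)) 1 = w"
      using a by blast+
    with a(5) have vw: "v = w" by simp
    with a(5) have "\<pi> - {#v#} = \<mu> - {#v#}" by (simp add: f_def)
    then show "\<pi> = \<mu> \<and> v = w" using vw a by (metis insert_DiffM)
  qed
  have "f ` Sigma ?A set_mset \<subseteq> partitions n"
  proof safe
    fix \<pi> v assume "\<pi> \<in> partitions n" "v \<in># \<pi>"
    then obtain \<mu> where "\<pi> = add_mset v \<mu>" by (metis multi_member_split)
    with \<open>\<pi> \<in> partitions n\<close> show "f (\<pi>, v) \<in> partitions n"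
      by (auto simp: f_def partitions_def split: if_splits)
  qed
  then have "card (Sigma ?A set_mset) \<le> card (partitions n)"
    using inj by (meson card_inj_on_le finite_partitions)
  then have *: "(\<Sum>\<pi>\<in>?A. card (set_mset \<pi>)) \<le> card (partitions n)"
    using fin by simp
  have "(d + 1) * card ?A = (\<Sum>\<pi>\<in>?A. d + 1)" by simp
  \<comment> \<open>Outside \<open>?B\<close> a partition has at least \<open>d + 1\<close> distinct
    parts; inside \<open>?B\<close> the extra term makes up for the missing ones.\<close>
  also have "\<dots> \<le> (\<Sum>\<pi>\<in>?A. card (set_mset \<pi>) + (d + 1) * of_bool (\<pi> \<in> ?B))"
    by (intro sum_mono) auto
  also have "\<dots> = (\<Sum>\<pi>\<in>?A. card (set_mset \<pi>)) + (d + 1) * card (?A \<inter> ?B)"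
    using fin by (simp add: sum.distrib sum_distrib_left[symmetric] Int_def del: of_bool_conj cong: conj_cong)
  also have "card (?A \<inter> ?B) \<le> card ?B" using fin by (intro card_mono) auto
  finally show ?thesis using * by (meson add_mono le_trans mult_le_mono2 order.refl)
qed

text \<open>The 8 in the threshold brings the count \<open>(n\<^sup>2) ^ d\<close> down to at most
  \<open>exp (sqrt n / 4)\<close>, whereas there are at least
  \<open>exp (1 / 2 * (sqrt n - 2))\<close> partitions.\<close>

lemma card_partitions_few_distinct_ratio:
  "eventually (\<lambda>n. real (card {\<pi> \<in> partitions n. real (card (set_mset \<pi>)) \<le> sqrt n / (8 * ln n)})
      \<le> 1 / n * card (partitions n)) at_top"
proof -
  have "eventually (\<lambda>n::nat. exp (sqrt n / 4) \<le> 1 / n * exp (1 / 2 * (sqrt n - 2))) at_top"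
    by real_asymp
  then show ?thesis
    using eventually_gt_at_top[of 1]
  proof eventually_elim
    case (elim n)
    define d where "d = nat \<lfloor>sqrt n / (8 * ln n)\<rfloor>"
    define m where "m = nat \<lfloor>sqrt n\<rfloor>"
    have m: "real m \<le> sqrt n" "sqrt n - 1 \<le> m" "0 < m"
      using elim unfolding m_def by (auto simp: le_nat_floor)
    have "(real m)\<^sup>2 \<le> (sqrt n)\<^sup>2" using m by (intro power_mono) auto
    then have m2: "m\<^sup>2 \<le> n" by (simp flip: of_nat_power)
    have "exp (1 / 2 * (sqrt n - 2)) \<le> exp (ln 2 * real (m - 1))"
    proof -
      have "1 / 2 * (sqrt n - 2) \<le> 1 / 2 * real (m - 1)" using m by (simp add: of_nat_diff)
      also have "\<dots> \<le> ln 2 * real (m - 1)" using ln2_ge_two_thirds by (intro mult_right_mono) auto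
      finally show ?thesis by simp
    qed
    also have "\<dots> = 2 ^ (m - 1)" by (simp add: mult.commute[of "ln 2"] exp_of_nat_mult)
    also have "\<dots> \<le> real (card (partitions n))"
      using card_partitions_ge_power_two[OF m2 m(3)] by (metis of_nat_le_iff of_nat_numeral of_nat_power)
    finally have low: "exp (1 / 2 * (sqrt n - 2)) \<le> real (card (partitions n))" .
    have d: "real d \<le> sqrt n / (8 * ln n)" using elim unfolding d_def by (simp add: le_nat_floor)
    have "{\<pi> \<in> partitions n. real (card (set_mset \<pi>)) \<le> sqrt n / (8 * ln n)}
        \<subseteq> {\<pi> \<in> partitions n. card (set_mset \<pi>) \<le> d}"
      unfolding d_def by (auto simp: le_nat_floor)
    then have "card {\<pi> \<in> partitions n. real (card (set_mset \<pi>)) \<le> sqrt n / (8 * ln n)}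
        \<le> card {\<pi> \<in> partitions n. card (set_mset \<pi>) \<le> d}"
      by (intro card_mono) (auto simp: finite_partitions)
    also have "\<dots> \<le> (n\<^sup>2) ^ d"
      using elim by (intro card_partitions_few_distinct) auto
    finally have "real (card {\<pi> \<in> partitions n. real (card (set_mset \<pi>)) \<le> sqrt n / (8 * ln n)})
        \<le> real ((n\<^sup>2) ^ d)" by linarith
    also have "\<dots> = exp (2 * ln n * d)"
      using elim by (simp add: exp_of_nat_mult mult.commute[of _ "real d"] exp_double)
    also have "\<dots> \<le> exp (sqrt n / 4)"
      using mult_left_mono[OF d, of "2 * ln n"] elim by (simp add: field_simps)
    also have "\<dots> \<le> 1 / n * exp (1 / 2 * (sqrt n - 2))" by (rule elim)
    also have "\<dots> \<le> 1 / n * card (partitions n)" using low by (intro mult_left_mono) auto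
    finally show ?case .
  qed
qed

text \<open>Taking \<open>d\<close> just below \<open>sqrt n / (8 * ln n)\<close> in
  \<open>card_partitions_no_ones\<close> gives the factor \<open>8 * ln n / sqrt n\<close>. The
  share \<open>1 / n\<close> of partitions with few distinct parts raises 8 to 9.\<close>

lemma card_partitions_no_ones_ratio:
  "eventually (\<lambda>n. real (card {\<pi> \<in> partitions n. count \<pi> 1 = 0})
      \<le> 9 * ln n / sqrt n * card (partitions n)) at_top"
proof -
  have "eventually (\<lambda>n::nat. 1 / real n \<le> ln n / sqrt n) at_top"
    by real_asymp
  then show ?thesis
    using card_partitions_few_distinct_ratio eventually_gt_at_top[of 1]
  proof eventually_elim
    case (elim n)
    let ?p = "real (card (partitions n))"
    define d where "d = nat \<lfloor>sqrt n / (8 * ln n)\<rfloor>"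
    have d: "real d \<le> sqrt n / (8 * ln n)" "sqrt n / (8 * ln n) \<le> real d + 1" "0 < sqrt n / (8 * ln n)"
      using elim unfolding d_def by (auto simp: le_nat_floor)
    have "{\<pi> \<in> partitions n. card (set_mset \<pi>) \<le> d}
        \<subseteq> {\<pi> \<in> partitions n. real (card (set_mset \<pi>)) \<le> sqrt n / (8 * ln n)}"
      using d by auto
    then have "card {\<pi> \<in> partitions n. card (set_mset \<pi>) \<le> d}
      \<le> card {\<pi> \<in> partitions n. real (card (set_mset \<pi>)) \<le> sqrt n / (8 * ln n)}"
      by (intro card_mono) (auto simp: finite_partitions)
    then have few: "real (card {\<pi> \<in> partitions n. card (set_mset \<pi>) \<le> d}) \<le> 1 / n * ?p"
      using elim by linarith
    have "real ((d + 1) * card {\<pi> \<in> partitions n. count \<pi> 1 = 0})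
       \<le> real (card (partitions n) + (d + 1) * card {\<pi> \<in> partitions n. card (set_mset \<pi>) \<le> d})"
      using card_partitions_no_ones[of d n] by (simp only: of_nat_le_iff)
    then have "(real d + 1) * card {\<pi> \<in> partitions n. count \<pi> 1 = 0}
       \<le> ?p + (real d + 1) * card {\<pi> \<in> partitions n. card (set_mset \<pi>) \<le> d}"
      by (simp add: algebra_simps)
    then have "real (card {\<pi> \<in> partitions n. count \<pi> 1 = 0})
       \<le> 1 / (real d + 1) * ?p + card {\<pi> \<in> partitions n. card (set_mset \<pi>) \<le> d}"
      by (simp add: field_simps)
    also have "\<dots> \<le> 1 / (sqrt n / (8 * ln n)) * ?p + 1 / n * ?p"
      using few d by (intro add_mono mult_right_mono divide_left_mono mult_pos_pos) auto
    also have "\<dots> \<le> 1 / (sqrt n / (8 * ln n)) * ?p + ln n / sqrt n * ?p"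
      using elim by (intro add_mono mult_right_mono) auto
    also have "\<dots> = 9 * ln n / sqrt n * ?p" by (simp add: field_simps)
    finally show ?case .
  qed
qed

text \<open>Removing a one leaves a partition of \<open>n - 1\<close>. Hence partitions without ones
  count the increments of the partition function.\<close>

lemma card_partitions_no_ones_eq:
  assumes "0 < n"
  shows "card (partitions n) = card (partitions (n - 1)) + card {\<pi> \<in> partitions n. count \<pi> 1 = 0}"
proof -
  have "card (partitions n) = card ({\<pi> \<in> partitions n. 1 \<le> count \<pi> 1} \<union> {\<pi> \<in> partitions n. count \<pi> 1 = 0})"
    by (intro arg_cong[of _ _ card]) (auto simp: count_eq_zero_iff)
  also have "\<dots> = card {\<pi> \<in> partitions n. 1 \<le> count \<pi> 1} + card {\<pi> \<in> partitions n. count \<pi> 1 = 0}"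
    by (intro card_Un_disjoint) (auto simp: finite_partitions count_eq_zero_iff)
  finally show ?thesis using card_partitions_count_ge[of 1 1 n] assms by simp
qed

text \<open>The partitions with fewer than \<open>r\<close> copies of \<open>j\<close> number
  \<open>card (partitions n) - card (partitions (n - r * j))\<close>. This telescopes into
  \<open>r * j\<close> increments, each a number of partitions without ones of some
  \<open>n - i\<close> between \<open>n / 2\<close> and \<open>n\<close>. Replacing
  \<open>sqrt (n - i)\<close> by \<open>sqrt n / 2\<close> turns 9 into 18.\<close>

lemma partitions_count_less_ratio:
  "eventually (\<lambda>n. \<forall>j r. 0 < j \<longrightarrow> 2 * (r * j) \<le> n \<longrightarrow>
     real (card {\<pi> \<in> partitions n. count \<pi> j < r})
      \<le> 18 * ln n / sqrt n * real (r * j) * card (partitions n)) at_top"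
proof -
  obtain N where N: "\<And>n. n \<ge> N \<Longrightarrow> real (card {\<pi> \<in> partitions n. count \<pi> 1 = 0})
      \<le> 9 * ln n / sqrt n * card (partitions n)"
    using card_partitions_no_ones_ratio unfolding eventually_at_top_linorder by blast
  show ?thesis
    using eventually_ge_at_top[of "2 * N + 2"]
  proof eventually_elim
    case (elim n)
    let ?p = "\<lambda>n. real (card (partitions n))"
    have step: "?p (n - i) - ?p (n - Suc i) \<le> 18 * ln n / sqrt n * ?p n" if i: "2 * Suc i \<le> n" for i
    proof -
      have "?p (n - i) - ?p (n - Suc i) = real (card {\<pi> \<in> partitions (n - i). count \<pi> 1 = 0})"
        using card_partitions_no_ones_eq[of "n - i"] i by simp
      also have "\<dots> \<le> 9 * ln (real (n - i)) / sqrt (real (n - i)) * ?p (n - i)"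
        using elim i by (intro N) auto
      also have "\<dots> \<le> 9 * ln n / (sqrt n / 2) * ?p n"
      proof (intro mult_mono frac_le)
        have "sqrt n / 2 = sqrt (n / 4)" by (simp add: real_sqrt_divide)
        also have "\<dots> \<le> sqrt (real (n - i))" using i by (intro real_sqrt_le_mono) auto
        finally show "sqrt n / 2 \<le> sqrt (real (n - i))" .
      qed (use i in \<open>auto simp: card_partitions_mono\<close>)
      finally show ?thesis by simp
    qed
    have tele: "?p n - ?p (n - i) \<le> 18 * ln n / sqrt n * real i * ?p n" if "2 * i \<le> n" for i
      using that
    proof (induction i)
      case (Suc i)
      then show ?case using step[of i] by (simp add: algebra_simps add_divide_distrib)
    qed simp
    show ?case
    proof (intro allI impI)
      fix j r :: nat assume jr: "0 < j" "2 * (r * j) \<le> n"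
      have "card (partitions n) = card ({\<pi> \<in> partitions n. r \<le> count \<pi> j} \<union> {\<pi> \<in> partitions n. count \<pi> j < r})"
        by (intro arg_cong[of _ _ card]) auto
      also have "\<dots> = card {\<pi> \<in> partitions n. r \<le> count \<pi> j} + card {\<pi> \<in> partitions n. count \<pi> j < r}"
        by (intro card_Un_disjoint) (auto simp: finite_partitions)
      finally have "real (card {\<pi> \<in> partitions n. count \<pi> j < r}) = ?p n - ?p (n - r * j)"
        using card_partitions_count_ge[of j r n] jr by simp
      then show "real (card {\<pi> \<in> partitions n. count \<pi> j < r}) \<le> 18 * ln n / sqrt n * real (r * j) * ?p n"
        using tele[of "r * j"] jr by simp
    qed
  qed
qed

section \<open>The Durfee square\<close>

text \<open>Because \<open>a\<close> and \<open>b\<close> vanish outside \<open>{1..D}\<close>, a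
  triple is determined as a whole by its partition, and \<open>of_durfee\<close> becomes a
  bijection.\<close>

definition durfee_triples :: "nat \<Rightarrow> (nat \<times> (nat \<Rightarrow> nat) \<times> (nat \<Rightarrow> nat)) set" where
  "durfee_triples n = {(D, a, b). (\<forall>j. j \<notin> {1..D} \<longrightarrow> a j = 0 \<and> b j = 0) \<and>
     D\<^sup>2 + (\<Sum>j=1..D. j * (a j + b j)) = n}"

text \<open>The first summand lists the rows through the Durfee square, the second those below it.\<close>

fun of_durfee :: "nat \<times> (nat \<Rightarrow> nat) \<times> (nat \<Rightarrow> nat) \<Rightarrow> nat multiset" where
  "of_durfee (D, a, b) =
     image_mset (\<lambda>i. D + (\<Sum>j=i..D. a j)) (mset_set {1..D}) + (\<Sum>j=1..D. replicate_mset (b j) j)"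

text \<open>Exchange of summation: \<open>a j\<close> occurs in the tails starting at 1 up to
  \<open>min j k\<close>. The value is the number of cells to the right of the square in the first
  \<open>k\<close> rows.\<close>

lemma sum_tails:
  fixes a :: "nat \<Rightarrow> nat"
  assumes "k \<le> D"
  shows "(\<Sum>i=1..k. \<Sum>j=i..D. a j) = (\<Sum>j=1..D. min j k * a j)"
  using assms
proof (induction k)
  case (Suc k)
  have "(\<Sum>j=Suc k..D. a j) = (\<Sum>j=1..D. if Suc k \<le> j then a j else 0)"
    by (intro sum.mono_neutral_cong_left) auto
  then have "(\<Sum>i=1..Suc k. \<Sum>j=i..D. a j) = (\<Sum>j=1..D. min j k * a j + (if Suc k \<le> j then a j else 0))"
    using Suc by (simp add: sum.distrib)
  also have "\<dots> = (\<Sum>j=1..D. min j (Suc k) * a j)"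
    by (intro sum.cong) (auto simp: min_def le_Suc_eq)
  finally show ?case .
qed simp

lemma count_sum_replicate_mset:
  "finite A \<Longrightarrow> count (\<Sum>j\<in>A. replicate_mset (b j) j) x = (if x \<in> A then b x else 0)"
  by (simp add: count_sum)

lemma sum_mset_sum_replicate:
  fixes f :: "nat \<Rightarrow> nat"
  assumes "finite A"
  shows "\<Sum>\<^sub># (image_mset f (\<Sum>j\<in>A. replicate_mset (b j) j)) = (\<Sum>j\<in>A. f j * b j)"
  using assms by (induction A rule: finite_induct) (auto simp: mult.commute)

lemma sum_mset_of_durfee:
  "\<Sum>\<^sub># (of_durfee (D, a, b)) = D\<^sup>2 + (\<Sum>j=1..D. j * (a j + b j))"
proof -
  have "\<Sum>\<^sub># (of_durfee (D, a, b)) = (\<Sum>i=1..D. D + (\<Sum>j=i..D. a j)) + (\<Sum>j=1..D. j * b j)"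
    using sum_mset_sum_replicate[of "{1..D}" "\<lambda>x. x" b] by (simp flip: sum_unfold_sum_mset)
  also have "(\<Sum>i=1..D. D + (\<Sum>j=i..D. a j)) = D\<^sup>2 + (\<Sum>j=1..D. min j D * a j)"
    by (simp add: sum.distrib sum_tails power2_eq_square flip: One_nat_def)
  also have "(\<Sum>j=1..D. min j D * a j) = (\<Sum>j=1..D. j * a j)"
    by (intro sum.cong) auto
  finally show ?thesis by (simp add: sum.distrib algebra_simps)
qed

lemma of_durfee_in_partitions: "t \<in> durfee_triples n \<Longrightarrow> of_durfee t \<in> partitions n"
proof (cases t)
  case (fields D a b)
  assume "t \<in> durfee_triples n"
  then have "\<Sum>\<^sub># (of_durfee t) = n"
    using sum_mset_of_durfee[of D a b] by (auto simp: fields durfee_triples_def)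
  moreover have "0 < x" if "x \<in># of_durfee t" for x
  proof (rule ccontr)
    assume "\<not> 0 < x"
    then have "count (of_durfee t) 0 \<noteq> 0" using that by auto
    then show False by (auto simp: fields count_sum_replicate_mset count_image_mset simp del: count_greater_zero_iff split: if_splits)
  qed
  ultimately show ?thesis by (auto simp: partitions_def)
qed

text \<open>Together the two bounds pin down \<open>D\<close>: no partition can satisfy them for two
  different sides.\<close>

lemma of_durfee_size_filter:
  shows "D \<le> size {#x \<in># of_durfee (D, a, b). D \<le> x#}"
    and "size {#x \<in># of_durfee (D, a, b). D < x#} \<le> D"
proof -
  let ?A = "image_mset (\<lambda>i. D + (\<Sum>j=i..D. a j)) (mset_set {1..D})"
  let ?B = "\<Sum>j=1..D. replicate_mset (b j) j"
  have "{#x \<in># ?A. D \<le> x#} = ?A" by (simp add: filter_mset_eq_conv)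
  then show "D \<le> size {#x \<in># of_durfee (D, a, b). D \<le> x#}" by simp
  have B: "{#x \<in># ?B. D < x#} = {#}" by (rule multiset_eqI) (simp add: count_sum_replicate_mset)
  show "size {#x \<in># of_durfee (D, a, b). D < x#} \<le> D"
    unfolding of_durfee.simps filter_union_mset B
    using size_filter_mset_lesseq[of "\<lambda>x. D < x" ?A] by simp
qed

text \<open>Parts above \<open>D\<close> come only from rows through the square, parts below
  \<open>D\<close> only from rows beneath it. Parts equal to \<open>D\<close> may be of either kind,
  but exactly \<open>D\<close> rows pass through the square, which settles their split.\<close>

lemma inj_on_of_durfee: "inj_on of_durfee (durfee_triples n)"
proof (rule inj_onI)
  fix u u'
  assume u: "u \<in> durfee_triples n" "u' \<in> durfee_triples n" "of_durfee u = of_durfee u'"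
  obtain D a b D' a' b' where uu: "u = (D, a, b)" "u' = (D', a', b')" by (metis prod_cases3)
  have t: "(D, a, b) \<in> durfee_triples n" "(D', a', b') \<in> durfee_triples n"
    and eq: "of_durfee (D, a, b) = of_durfee (D', a', b')"
    using u uu by auto
  have less: "\<not> D < D'" if "of_durfee (D, a, b) = of_durfee (D', a', b')" for D a b D' a' b'
  proof
    assume "D < D'"
    have "D' \<le> size {#x \<in># of_durfee (D', a', b'). D' \<le> x#}" by (rule of_durfee_size_filter)
    also have "\<dots> \<le> size {#x \<in># of_durfee (D, a, b). D < x#}"
      unfolding that[symmetric] using \<open>D < D'\<close> by (intro size_mset_mono) (auto simp: subseteq_mset_def)
    also have "\<dots> \<le> D" by (rule of_durfee_size_filter)
    finally show False using \<open>D < D'\<close> by simp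
  qed
  have D: "D' = D" using less[OF eq] less[OF eq[symmetric]] by simp
  let ?f = "\<lambda>a i. D + (\<Sum>j=i..D. a j)"
  let ?A = "\<lambda>a. image_mset (?f a) (mset_set {1..D})"
  let ?B = "\<lambda>b. \<Sum>j=1..D. replicate_mset (b j) j"
  have eq': "?A a + ?B b = ?A a' + ?B b'" using eq D by simp
  have cA: "count (?A a) x = 0" if "x < D" for x a
    using that by (auto simp: count_eq_zero_iff)
  have cB: "count (?B b) x = (if x \<in> {1..D} then b x else 0)" for x b
    by (rule count_sum_replicate_mset) simp
  have c1: "count (?A a) x = count (?A a') x" if "x \<noteq> D" for x
    using arg_cong[OF eq', of "\<lambda>M. count M x"] that cA[of x a] cA[of x a']
    unfolding count_union cB by (cases "x < D") auto
  have "size (?A a) = size (?A a')" by simp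
  have split: "size M = count M D + size {#x \<in># M. x \<noteq> D#}" for M
    by (induction M) auto
  have "{#x \<in># ?A a. x \<noteq> D#} = {#x \<in># ?A a'. x \<noteq> D#}"
    using c1 by (intro multiset_eqI) auto
  then have "count (?A a) D = count (?A a') D"
    using split[of "?A a"] split[of "?A a'"] \<open>size (?A a) = size (?A a')\<close> by (metis add_right_cancel)
  with c1 have A: "?A a = ?A a'" by (metis multiset_eqI)
  with eq' have B: "?B b = ?B b'" by simp
  have b: "b = b'"
  proof
    fix j show "b j = b' j"
      using arg_cong[OF B, of "\<lambda>M. count M j"] t unfolding cB D durfee_triples_def
      by (cases "j \<in> {1..D}") auto
  qed
  \<comment> \<open>The rows are listed in decreasing order, so equal multisets give equal lists.
    Differences of consecutive rows then recover \<open>a\<close>.\<close>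
  define l where "l = (\<lambda>a. map (?f a) [1..<Suc D])"
  have ml: "mset (l a) = ?A a" for a
    unfolding l_def mset_map by (simp add: atLeastLessThanSuc_atLeastAtMost del: upt_Suc)
  have sl: "sorted (rev (l a))" for a
    unfolding l_def sorted_iff_nth_mono
  proof safe
    fix i j assume ij: "i \<le> j" "j < length (rev (map (?f a) [1..<Suc D]))"
    have j: "j < D" using ij by (simp del: upt_Suc)
    have "rev (map (?f a) [1..<Suc D]) ! i = ?f a (D - i)" if "i < D" for i
      using that by (simp add: rev_nth Suc_diff_Suc del: upt_Suc)
    then show "rev (map (?f a) [1..<Suc D]) ! i \<le> rev (map (?f a) [1..<Suc D]) ! j"
      using ij j by (auto intro!: sum_mono2)
  qed
  have "rev (l a) = rev (l a')"
    using sl[of a] sl[of a'] ml[of a] ml[of a'] A by (metis mset_rev properties_for_sort)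
  then have f: "?f a i = ?f a' i" if "i \<in> {1..D}" for i
    using that unfolding l_def by (auto simp del: upt_Suc)
  have a: "a = a'"
  proof
    fix i show "a i = a' i"
    proof (cases "i \<in> {1..D}")
      case True
      have "?f c i = c i + ?f c (Suc i)" for c
        using True by (simp add: sum.atLeast_Suc_atMost)
      moreover have "?f a (Suc i) = ?f a' (Suc i)"
        using f[of "Suc i"] True by (cases "i = D") auto
      ultimately show ?thesis using f[OF True] by (metis add_right_cancel)
    next
      case False
      then show ?thesis using t D by (auto simp: durfee_triples_def)
    qed
  qed
  show "u = u'" using D a b uu by simp
qed

text \<open>The side is the largest \<open>d\<close> with at least \<open>d\<close> parts of size at
  least \<open>d\<close>. The parts above it, completed by parts equal to it, are the rows through
  the square. Their consecutive differences form \<open>a\<close>, and the multiplicities of the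
  other parts form \<open>b\<close>.\<close>

lemma partitions_subset_of_durfee: "partitions n \<subseteq> of_durfee ` durfee_triples n"
proof
  fix p assume p: "p \<in> partitions n"
  let ?P = "\<lambda>d. d \<le> size {#x \<in># p. d \<le> x#}"
  define D where "D = Greatest ?P"
  have bd: "d \<le> size p" if "?P d" for d
    using that size_filter_mset_lesseq[of "\<lambda>x. d \<le> x" p] by linarith
  have D1: "?P D" unfolding D_def by (rule GreatestI_nat[of ?P 0 "size p"]) (use bd in auto)
  have "\<not> ?P (Suc D)"
  proof
    assume "?P (Suc D)"
    then have "Suc D \<le> D" unfolding D_def by (rule Greatest_le_nat[of ?P _ "size p"]) (use bd in auto)
    then show False by simp
  qed
  then have D2: "size {#x \<in># p. D < x#} \<le> D" by (simp add: Suc_le_eq)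
  \<comment> \<open>Only \<open>r\<close> of the parts equal to \<open>D\<close> are rows through
    the square; any others are rows of length \<open>D\<close> beneath it.\<close>
  define r where "r = D - size {#x \<in># p. D < x#}"
  define A where "A = {#x \<in># p. D < x#} + replicate_mset r D"
  define B where "B = p - A"
  have "size {#x \<in># p. D \<le> x#} = size {#x \<in># p. D < x#} + count p D"
    by (induction p) auto
  then have r: "r \<le> count p D" using D1 unfolding r_def by linarith
  have sA: "size A = D" using D2 unfolding A_def r_def by simp
  have Ap: "A \<subseteq># p" unfolding A_def using r by (auto simp: subseteq_mset_def)
  then have pAB: "p = A + B" unfolding B_def by simp
  have Age: "D \<le> x" if "x \<in># A" for x using that unfolding A_def by (auto split: if_splits)
  have cB0: "count B x = 0" if "x \<notin> {1..D}" for x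
  proof (cases "x = 0")
    case True
    then show ?thesis using p pAB by (auto simp: partitions_def count_eq_zero_iff)
  next
    case False
    then show ?thesis using that unfolding B_def A_def by (auto simp: count_eq_zero_iff)
  qed
  define ys where "ys = rev (sorted_list_of_multiset A)"
  have mys: "mset ys = A" unfolding ys_def by simp
  have lys: "length ys = D" using sA mys by (metis size_mset)
  have sys: "ys ! j \<le> ys ! i" if "i \<le> j" "j < D" for i j
  proof -
    have "sorted (rev ys)" unfolding ys_def by simp
    then show ?thesis using that lys by (simp add: sorted_rev_iff_nth_mono)
  qed
  \<comment> \<open>Rows are numbered from 0 here. The value \<open>D\<close> after the last row
    makes \<open>a D\<close> the excess of that row over the square.\<close>
  define y where "y = (\<lambda>i. if i < D then ys ! i else D)"
  have ymono: "y (Suc i) \<le> y i" if "i < D" for i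
    using that sys[of i "Suc i"] Age lys mys unfolding y_def by (auto dest: nth_mem)
  define a where "a = (\<lambda>j. if j \<in> {1..D} then y (j - 1) - y j else 0)"
  have fa: "D + (\<Sum>j=i..D. a j) = y (i - 1)" if "1 \<le> i" "i \<le> Suc D" for i
    using that(2,1)
  proof (induction i rule: inc_induct)
    case base
    show ?case by (simp add: y_def)
  next
    case (step m)
    have "(\<Sum>j=m..D. a j) = a m + (\<Sum>j=Suc m..D. a j)"
      using step.hyps by (intro sum.atLeast_Suc_atMost) auto
    moreover have "a m = y (m - 1) - y m" "y m \<le> y (m - 1)"
      using step ymono[of "m - 1"] by (auto simp: a_def)
    ultimately show ?case using step by simp
  qed
  have "image_mset (\<lambda>i. D + (\<Sum>j=i..D. a j)) (mset_set {1..D}) = image_mset (\<lambda>i. y (i - 1)) (mset_set {1..D})"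
    using fa by (intro image_mset_cong) auto
  also have "\<dots> = mset (map (\<lambda>i. y (i - 1)) [1..<Suc D])"
    unfolding mset_map by (simp add: atLeastLessThanSuc_atLeastAtMost del: upt_Suc)
  also have "map (\<lambda>i. y (i - 1)) [1..<Suc D] = ys"
    by (rule nth_equalityI) (auto simp: lys y_def simp del: upt_Suc)
  finally have imA: "image_mset (\<lambda>i. D + (\<Sum>j=i..D. a j)) (mset_set {1..D}) = A" using mys by simp
  have "(\<Sum>j=1..D. replicate_mset (count B j) j) = B"
    using cB0 by (intro multiset_eqI) (auto simp: count_sum_replicate_mset)
  then have pd: "of_durfee (D, a, count B) = p" using imA pAB by simp
  moreover have "(D, a, count B) \<in> durfee_triples n"
    using sum_mset_of_durfee[of D a "count B"] pd p cB0
    by (auto simp: durfee_triples_def partitions_def a_def)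
  ultimately show "p \<in> of_durfee ` durfee_triples n" by (metis image_eqI)
qed

lemma bij_betw_of_durfee: "bij_betw of_durfee (durfee_triples n) (partitions n)"
  using inj_on_of_durfee partitions_subset_of_durfee of_durfee_in_partitions
  unfolding bij_betw_def by blast

text \<open>For \<open>j = D\<close> there is only an inequality, since rows through the square may
  have length exactly \<open>D\<close>.\<close>

lemma count_of_durfee:
  assumes "j \<in> {1..D}"
  shows "b j \<le> count (of_durfee (D, a, b)) j"
    and "j < D \<Longrightarrow> count (of_durfee (D, a, b)) j = b j"
  using assms by (auto simp: count_sum_replicate_mset count_eq_zero_iff)

text \<open>The rows through the square and the rows beneath it take at most \<open>D\<close> values
  each. Hence many distinct parts force a large square.\<close>

lemma card_set_of_durfee: "card (set_mset (of_durfee (D, a, b))) \<le> 2 * D"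
proof -
  have "set_mset (of_durfee (D, a, b)) \<subseteq> (\<lambda>i. D + (\<Sum>j=i..D. a j)) ` {1..D} \<union> {1..D}"
  proof
    fix x assume "x \<in># of_durfee (D, a, b)"
    then have "x \<in> (\<lambda>i. D + (\<Sum>j=i..D. a j)) ` {1..D} \<or> x \<in># (\<Sum>j=1..D. replicate_mset (b j) j)"
      by auto
    moreover have "x \<in> {1..D}" if "x \<in># (\<Sum>j=1..D. replicate_mset (b j) j)"
      using that count_sum_replicate_mset[of "{1..D}" b x] by (auto simp: count_eq_zero_iff split: if_splits)
    ultimately show "x \<in> (\<lambda>i. D + (\<Sum>j=i..D. a j)) ` {1..D} \<union> {1..D}" by blast
  qed
  then have "card (set_mset (of_durfee (D, a, b))) \<le> card ((\<lambda>i. D + (\<Sum>j=i..D. a j)) ` {1..D} \<union> {1..D})"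
    by (intro card_mono) auto
  also have "\<dots> \<le> card ((\<lambda>i. D + (\<Sum>j=i..D. a j)) ` {1..D}) + card {1..D}" by (rule card_Un_le)
  also have "card ((\<lambda>i. D + (\<Sum>j=i..D. a j)) ` {1..D}) \<le> D"
    using card_image_le[of "{1..D}" "\<lambda>i. D + (\<Sum>j=i..D. a j)"] by simp
  finally show ?thesis by simp
qed

section \<open>A necessary condition for graphical partitions\<close>

lemma degree_eq_card_neighbours:
  assumes "simple_graph V E" "u \<in> V"
  shows "degree E u = card {w \<in> V. {u, w} \<in> E}"
proof -
  have "bij_betw (\<lambda>w. {u, w}) {w \<in> V. {u, w} \<in> E} {e \<in> E. u \<in> e}"
    unfolding bij_betw_def
  proof safe
    show "inj_on (\<lambda>w. {u, w}) {w \<in> V. {u, w} \<in> E}" by (auto simp: inj_on_def doubleton_eq_iff)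
  next
    fix e assume e: "e \<in> E" "u \<in> e"
    then have "e \<subseteq> V" "card e = 2" using assms by (auto simp: simple_graph_def)
    then obtain w where "e = {u, w}" using e(2) by (auto simp: card_2_iff)
    then show "e \<in> (\<lambda>w. {u, w}) ` {w \<in> V. {u, w} \<in> E}" using e \<open>e \<subseteq> V\<close> by auto
  qed
  then show ?thesis unfolding degree_def by (simp add: bij_betw_same_card)
qed

text \<open>Count the adjacent pairs starting in \<open>U\<close> by their second vertex. As there
  are no loops, a vertex of \<open>U\<close> has at most \<open>card U - 1\<close> neighbours in
  \<open>U\<close>; a vertex outside has at most its degree and at most
  \<open>card U\<close>.\<close>

lemma erdos_gallai_necessary:
  assumes g: "simple_graph V E" and U: "U \<subseteq> V"
  shows "(\<Sum>u\<in>U. degree E u) \<le> card U * (card U - 1) + (\<Sum>v\<in>V - U. min (degree E v) (card U))"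
proof -
  have fin: "finite V" "finite U" using g U finite_subset by (auto simp: simple_graph_def)
  let ?N = "\<lambda>w. {u \<in> U. {u, w} \<in> E}"
  have "(\<Sum>u\<in>U. degree E u) = (\<Sum>u\<in>U. \<Sum>w\<in>V. of_bool ({u, w} \<in> E))"
    using degree_eq_card_neighbours[OF g] U fin by (intro sum.cong) (auto simp: Int_def)
  also have "\<dots> = (\<Sum>w\<in>V. \<Sum>u\<in>U. of_bool ({u, w} \<in> E))" by (rule sum.swap)
  also have "\<dots> = (\<Sum>w\<in>V. card (?N w))" using fin by (intro sum.cong) (auto simp: Int_def)
  also have "\<dots> = (\<Sum>w\<in>V - U. card (?N w)) + (\<Sum>w\<in>U. card (?N w))"
    using fin U by (intro sum.subset_diff) auto
  also have "(\<Sum>w\<in>U. card (?N w)) \<le> (\<Sum>w\<in>U. card U - 1)"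
  proof (intro sum_mono)
    fix w assume w: "w \<in> U"
    have "{w, w} \<notin> E" using g by (auto simp: simple_graph_def)
    then have "?N w \<subseteq> U - {w}" by auto
    then have "card (?N w) \<le> card (U - {w})" using fin by (intro card_mono) auto
    then show "card (?N w) \<le> card U - 1" using w fin by simp
  qed
  also have "(\<Sum>w\<in>V - U. card (?N w)) \<le> (\<Sum>v\<in>V - U. min (degree E v) (card U))"
  proof (intro sum_mono)
    fix w assume w: "w \<in> V - U"
    have "degree E w = card {u \<in> V. {w, u} \<in> E}" using degree_eq_card_neighbours[OF g] w by auto
    moreover have "?N w \<subseteq> {u \<in> V. {w, u} \<in> E}" using U by (auto simp: insert_commute)
    ultimately have "card (?N w) \<le> degree E w" using fin by (auto intro!: card_mono)
    moreover have "card (?N w) \<le> card U" using fin by (auto intro!: card_mono)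
    ultimately show "card (?N w) \<le> min (degree E w) (card U)" by simp
  qed
  finally show ?thesis by (simp add: ac_simps)
qed

text \<open>This lifts a splitting of the degree sequence to one of the vertex set. Multiplicities
  in a submultiset of \<open>mset_set V\<close> are at most 1, so it comes from a set.\<close>

lemma image_mset_set_eq_plusD:
  assumes "finite V" "image_mset f (mset_set V) = M + N"
  obtains U where "U \<subseteq> V" "image_mset f (mset_set U) = M" "image_mset f (mset_set (V - U)) = N"
proof -
  obtain B C where BC: "mset_set V = B + C" "M = image_mset f B" "N = image_mset f C"
    using image_mset_eq_plusD[OF assms(2)] by blast
  have c: "count B x + count C x = (if x \<in> V then 1 else 0)" for x
    using arg_cong[OF BC(1), of "\<lambda>M. count M x"] assms(1) by (simp add: count_mset_set')
  have c1: "count B x + count C x \<le> 1" for x unfolding c by simp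
  have U: "set_mset B \<subseteq> V"
  proof
    fix x assume "x \<in># B" then show "x \<in> V" using c[of x] by (auto simp: count_eq_zero_iff split: if_splits)
  qed
  have B: "mset_set (set_mset B) = B"
  proof (rule multiset_eqI)
    fix x show "count (mset_set (set_mset B)) x = count B x"
    proof (cases "x \<in># B")
      case True
      then have "0 < count B x" by simp
      then have "count B x = 1" using c1[of x] by linarith
      then show ?thesis using True by simp
    next
      case False
      then show ?thesis by (simp add: count_eq_zero_iff)
    qed
  qed
  have "mset_set (V - set_mset B) = C"
  proof (rule multiset_eqI)
    fix x show "count (mset_set (V - set_mset B)) x = count C x"
    proof (cases "x \<in># B")
      case True
      then have "0 < count B x" by simp
      then have "count C x = 0" using c1[of x] by linarith
      then show ?thesis using True assms(1) by simp
    next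
      case False
      then have "count B x = 0" by (simp add: count_eq_zero_iff)
      then show ?thesis using c[of x] False assms(1) by simp
    qed
  qed
  with B BC U that[of "set_mset B"] show ?thesis by simp
qed

text \<open>Apply \<open>erdos_gallai_necessary\<close> to vertices carrying the first
  \<open>k\<close> rows. The square contributes \<open>k * D\<close> on the left. On the right the
  rows from \<open>k + 1\<close> to \<open>D\<close> are cut down to \<open>k\<close>, and with
  \<open>k * (k - 1)\<close> they contribute at most \<open>k * D\<close>. What remains compares
  \<open>a\<close> with \<open>b\<close>.\<close>

lemma graphical_of_durfee_imp:
  assumes "graphical (of_durfee (D, a, b))" "k \<le> D"
  shows "(\<Sum>j=1..D. min j k * a j) \<le> (\<Sum>j=1..D. min j k * b j)"
proof -
  let ?f = "\<lambda>i. D + (\<Sum>j=i..D. a j)"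
  let ?B = "\<Sum>j=1..D. replicate_mset (b j) j"
  obtain V :: "nat set" and E where g: "simple_graph V E" and d: "degree_sequence V E = of_durfee (D, a, b)"
    using assms(1) unfolding graphical_def by blast
  have fin: "finite V" using g by (simp add: simple_graph_def)
  have "{1..D} = {1..k} \<union> {Suc k..D}" using assms(2) by auto
  then have "mset_set {1..D} = mset_set {1..k} + mset_set {Suc k..D}"
    by (simp add: mset_set_Union)
  then have "image_mset (degree E) (mset_set V)
      = image_mset ?f (mset_set {1..k}) + (image_mset ?f (mset_set {Suc k..D}) + ?B)"
    using d unfolding degree_sequence_def by (simp add: ac_simps)
  then obtain U where U: "U \<subseteq> V" "image_mset (degree E) (mset_set U) = image_mset ?f (mset_set {1..k})"
    "image_mset (degree E) (mset_set (V - U)) = image_mset ?f (mset_set {Suc k..D}) + ?B"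
    by (rule image_mset_set_eq_plusD[OF fin])
  have cU: "card U = k" using arg_cong[OF U(2), of size] by simp
  have "(\<Sum>u\<in>U. degree E u) = (\<Sum>i=1..k. ?f i)"
    using arg_cong[OF U(2), of sum_mset] by (simp flip: sum_unfold_sum_mset)
  also have "\<dots> = k * D + (\<Sum>j=1..D. min j k * a j)"
    using sum_tails[OF assms(2), of a] by (simp add: sum.distrib)
  finally have s1: "(\<Sum>u\<in>U. degree E u) = k * D + (\<Sum>j=1..D. min j k * a j)" .
  have "(\<Sum>v\<in>V - U. min (degree E v) k) = \<Sum>\<^sub># (image_mset (\<lambda>x. min x k) (image_mset (degree E) (mset_set (V - U))))"
    by (simp add: sum_unfold_sum_mset image_mset.compositionality comp_def)
  also have "\<dots> = (\<Sum>i=Suc k..D. min (?f i) k) + (\<Sum>j=1..D. min j k * b j)"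
    unfolding U(3) using sum_mset_sum_replicate[of "{1..D}" "\<lambda>x. min x k" b]
    by (simp add: image_mset.compositionality comp_def flip: sum_unfold_sum_mset)
  also have "(\<Sum>i=Suc k..D. min (?f i) k) = (\<Sum>i=Suc k..D. k)"
    using assms(2) by (intro sum.cong) auto
  finally have s2: "(\<Sum>v\<in>V - U. min (degree E v) k) = (D - k) * k + (\<Sum>j=1..D. min j k * b j)" by simp
  have "k * (k - 1) + (D - k) * k \<le> k * D"
  proof -
    have "k * (k - 1) + (D - k) * k \<le> k * k + (D - k) * k" by simp
    also have "\<dots> = k * D" using assms(2) by (simp add: algebra_simps flip: add_mult_distrib2)
    finally show ?thesis .
  qed
  then show ?thesis using erdos_gallai_necessary[OF g U(1)] s1 s2 cU by simp
qed

section \<open>Sums of independent uniform variables\<close>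

text \<open>Completing the square in \<open>m\<^sup>2\<close> and then in \<open>m\<close> leaves a
  positive constant. The quartic is the test function in \<open>prob_less_neg_ge\<close>.\<close>

lemma quartic_le_ten: "- 1 / 4 - 5 / 3 * m + m\<^sup>2 - m ^ 4 / 18 \<le> (10::real)"
proof -
  have "10 - (- 1 / 4 - 5 / 3 * m + m\<^sup>2 - m ^ 4 / 18)
      = (m\<^sup>2 - 56 / 5)\<^sup>2 / 18 + 11 / 45 * (m + 75 / 22)\<^sup>2 + (10 + 1 / 4 - 3136 / 450 - 11 / 45 * (75 / 22)\<^sup>2)"
    by (simp add: power2_eq_square power4_eq_xxxx field_simps)
  also have "\<dots> \<ge> 0" by (intro add_nonneg_nonneg) (auto simp: power2_eq_square)
  finally show ?thesis by simp
qed

lemma quartic_nonpos: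
  fixes m :: real
  assumes "- 1 / 10 \<le> m"
  shows "- 1 / 4 - 5 / 3 * m + m\<^sup>2 - m ^ 4 / 18 \<le> 0"
proof (cases "0 \<le> m")
  case True
  \<comment> \<open>The cubic \<open>m ^ 3 - 18 * m + 30\<close> has its minimum over positive
    \<open>m\<close> at \<open>sqrt 6\<close>, which \<open>49 / 20\<close> approximates; the
    minimum is positive.\<close>
  have "0 \<le> (m - 49 / 20)\<^sup>2 * (m + 49 / 10) + 3 / 400 * m + 2351 / 4000" using True by simp
  also have "\<dots> = m ^ 3 - 18 * m + 30"
    by (simp add: power2_eq_square power3_eq_cube field_simps)
  finally have "0 \<le> m * (m ^ 3 - 18 * m + 30)" using True by simp
  then show ?thesis by (simp add: power2_eq_square power3_eq_cube power4_eq_xxxx algebra_simps)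
next
  case False
  have "m\<^sup>2 \<le> (1 / 10)\<^sup>2" using assms False by (intro power2_le_iff_abs_le[THEN iffD2]) auto
  then have "m\<^sup>2 \<le> 1 / 100" by (simp add: power_divide)
  moreover have "0 \<le> m ^ 4" by simp
  ultimately show ?thesis using assms by linarith
qed

text \<open>A one-sided Paley--Zygmund inequality: the quartic is at most 10, and nonpositive
  outside the event, while its mean is at least 1/4.\<close>

lemma prob_less_neg_ge:
  fixes M :: "'a \<Rightarrow> real"
  assumes fin: "finite (set_pmf P)"
    and m1: "measure_pmf.expectation P M = 0"
    and m2: "measure_pmf.expectation P (\<lambda>x. (M x)\<^sup>2) = v" and v: "0 < v"
    and m4: "measure_pmf.expectation P (\<lambda>x. M x ^ 4) \<le> 9 * v\<^sup>2"
  shows "1 / 40 \<le> measure_pmf.prob P {x. M x < - (sqrt v / 10)}"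
proof -
  let ?E = "measure_pmf.expectation P"
  let ?A = "{x. M x < - (sqrt v / 10)}"
  have int [simp]: "integrable (measure_pmf P) f" for f :: "'a \<Rightarrow> real"
    using fin by (rule integrable_measure_pmf_finite)
  define q where "q = (\<lambda>x. - 1 / 4 - 5 / 3 * (M x / sqrt v) + (M x / sqrt v)\<^sup>2 - (M x / sqrt v) ^ 4 / 18)"
  have sv: "sqrt v ^ 4 = v\<^sup>2" using v by (simp add: power4_eq_xxxx power2_eq_square)
  have "q x \<le> 10 * indicator ?A x" for x
  proof (cases "x \<in> ?A")
    case True
    then show ?thesis using quartic_le_ten[of "M x / sqrt v"] by (simp add: q_def)
  next
    case False
    then have "- 1 / 10 \<le> M x / sqrt v" using v by (simp add: field_simps)
    then show ?thesis using quartic_nonpos[of "M x / sqrt v"] False by (simp add: q_def)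
  qed
  then have "?E q \<le> ?E (\<lambda>x. 10 * indicator ?A x)" by (intro integral_mono int) auto
  also have "\<dots> = 10 * measure_pmf.prob P ?A" by simp
  finally have 1: "?E q \<le> 10 * measure_pmf.prob P ?A" .
  \<comment> \<open>The normalised first, second and fourth moments are 0, 1 and at most 9, so the
    mean is at least - 1/4 + 1 - 9/18.\<close>
  have "?E q = - 1 / 4 - 5 / 3 * (?E M / sqrt v) + ?E (\<lambda>x. (M x)\<^sup>2) / v - ?E (\<lambda>x. M x ^ 4) / v\<^sup>2 / 18"
    unfolding q_def power_divide using v sv by simp
  also have "\<dots> = 3 / 4 - ?E (\<lambda>x. M x ^ 4) / v\<^sup>2 / 18" using m1 m2 v by simp
  also have "?E (\<lambda>x. M x ^ 4) / v\<^sup>2 / 18 \<le> 1 / 2" using m4 v by (simp add: field_simps)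
  then have "3 / 4 - ?E (\<lambda>x. M x ^ 4) / v\<^sup>2 / 18 \<ge> 1 / 4" by simp
  finally show ?thesis using 1 by simp
qed

text \<open>For independent centred summands the mixed terms with an odd exponent vanish. In the
  fourth moment the product of the two variances appears with factor 6, in nine times the squared
  total variance with factor 18. Hence the kurtosis bound 9 survives addition.\<close>

lemma indep_sum_moments:
  fixes X :: "'i \<Rightarrow> 'a \<Rightarrow> real"
  assumes "finite (set_pmf P)" "finite I"
    and "prob_space.indep_vars (measure_pmf P) (\<lambda>_. borel) X I"
    and "\<And>i. i \<in> I \<Longrightarrow> measure_pmf.expectation P (X i) = 0"
    and "\<And>i. i \<in> I \<Longrightarrow> measure_pmf.expectation P (\<lambda>x. X i x ^ 4) \<le> 9 * (measure_pmf.expectation P (\<lambda>x. (X i x)\<^sup>2))\<^sup>2"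
  shows "measure_pmf.expectation P (\<lambda>x. \<Sum>i\<in>I. X i x) = 0 \<and>
    measure_pmf.expectation P (\<lambda>x. (\<Sum>i\<in>I. X i x)\<^sup>2) = (\<Sum>i\<in>I. measure_pmf.expectation P (\<lambda>x. (X i x)\<^sup>2)) \<and>
    measure_pmf.expectation P (\<lambda>x. (\<Sum>i\<in>I. X i x) ^ 4) \<le> 9 * (\<Sum>i\<in>I. measure_pmf.expectation P (\<lambda>x. (X i x)\<^sup>2))\<^sup>2"
  using assms(2-)
proof (induction I rule: finite_induct)
  case empty
  then show ?case by simp
next
  case (insert j I)
  note ps = measure_pmf.prob_space_axioms[of P]
  let ?E = "measure_pmf.expectation P"
  have int [simp]: "integrable (measure_pmf P) f" for f :: "'a \<Rightarrow> real"
    using assms(1) by (rule integrable_measure_pmf_finite)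
  define Y where "Y = X j"
  define S where "S = (\<lambda>x. \<Sum>i\<in>I. X i x)"
  have "prob_space.indep_vars (measure_pmf P) (\<lambda>_. borel) X I"
    using insert.prems(1) by (rule prob_space.indep_vars_subset[OF ps]) auto
  then have IH: "?E S = 0" "?E (\<lambda>x. (S x)\<^sup>2) = (\<Sum>i\<in>I. ?E (\<lambda>x. (X i x)\<^sup>2))"
    "?E (\<lambda>x. S x ^ 4) \<le> 9 * (?E (\<lambda>x. (S x)\<^sup>2))\<^sup>2"
    using insert.IH insert.prems by (auto simp: S_def)
  have Y: "?E Y = 0" "?E (\<lambda>x. Y x ^ 4) \<le> 9 * (?E (\<lambda>x. (Y x)\<^sup>2))\<^sup>2"
    using insert.prems by (auto simp: Y_def)
  have ind: "prob_space.indep_var (measure_pmf P) borel Y borel S"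
    unfolding Y_def S_def using insert.hyps insert.prems by (intro prob_space.indep_vars_sum[OF ps]) auto
  have pr: "?E (\<lambda>x. Y x ^ a * S x ^ b) = ?E (\<lambda>x. Y x ^ a) * ?E (\<lambda>x. S x ^ b)" for a b
    using prob_space.indep_var_lebesgue_integral[OF ps prob_space.indep_var_compose[OF ps ind, of "\<lambda>y. y ^ a" borel "\<lambda>y. y ^ b" borel]]
    by (simp add: comp_def)
  have e2: "?E (\<lambda>x. (Y x + S x)\<^sup>2) = ?E (\<lambda>x. (Y x)\<^sup>2) + ?E (\<lambda>x. (S x)\<^sup>2)"
  proof -
    have "?E (\<lambda>x. (Y x + S x)\<^sup>2) = ?E (\<lambda>x. (Y x)\<^sup>2 + 2 * (Y x ^ 1 * S x ^ 1) + (S x)\<^sup>2)"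
      by (simp add: power2_eq_square algebra_simps)
    also have "\<dots> = ?E (\<lambda>x. (Y x)\<^sup>2) + 2 * ?E (\<lambda>x. Y x ^ 1 * S x ^ 1) + ?E (\<lambda>x. (S x)\<^sup>2)"
      by (simp del: power_one_right)
    finally show ?thesis using pr[of 1 1] Y IH by simp
  qed
  have "?E (\<lambda>x. (Y x + S x) ^ 4)
      = ?E (\<lambda>x. Y x ^ 4 + 4 * (Y x ^ 3 * S x ^ 1) + 6 * (Y x ^ 2 * S x ^ 2) + 4 * (Y x ^ 1 * S x ^ 3) + S x ^ 4)"
    by (intro arg_cong[of _ _ ?E]) (auto simp: power4_eq_xxxx power3_eq_cube power2_eq_square algebra_simps)
  also have "\<dots> = ?E (\<lambda>x. Y x ^ 4) + 4 * ?E (\<lambda>x. Y x ^ 3 * S x ^ 1) + 6 * ?E (\<lambda>x. Y x ^ 2 * S x ^ 2)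
      + 4 * ?E (\<lambda>x. Y x ^ 1 * S x ^ 3) + ?E (\<lambda>x. S x ^ 4)"
    by (simp del: power_one_right)
  also have "\<dots> = ?E (\<lambda>x. Y x ^ 4) + 6 * (?E (\<lambda>x. (Y x)\<^sup>2) * ?E (\<lambda>x. (S x)\<^sup>2)) + ?E (\<lambda>x. S x ^ 4)"
    using pr[of 3 1] pr[of 2 2] pr[of 1 3] Y IH by simp
  also have "\<dots> \<le> 9 * (?E (\<lambda>x. (Y x)\<^sup>2))\<^sup>2 + 18 * (?E (\<lambda>x. (Y x)\<^sup>2) * ?E (\<lambda>x. (S x)\<^sup>2)) + 9 * (?E (\<lambda>x. (S x)\<^sup>2))\<^sup>2"
  proof -
    have "0 \<le> ?E (\<lambda>x. (Y x)\<^sup>2) * ?E (\<lambda>x. (S x)\<^sup>2)" by simp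
    then show ?thesis using Y(2) IH(3) by linarith
  qed
  also have "\<dots> = 9 * (?E (\<lambda>x. (Y x)\<^sup>2) + ?E (\<lambda>x. (S x)\<^sup>2))\<^sup>2"
    by (simp add: power2_eq_square algebra_simps)
  finally have e4: "?E (\<lambda>x. (Y x + S x) ^ 4) \<le> 9 * (?E (\<lambda>x. (Y x)\<^sup>2) + ?E (\<lambda>x. (S x)\<^sup>2))\<^sup>2" .
  have e1: "?E (\<lambda>x. Y x + S x) = 0" using Y IH by simp
  show ?case using e1 e2 e4 IH(2) insert.hyps unfolding S_def Y_def by simp
qed

text \<open>With \<open>b = s - a\<close> the variable is \<open>b - a\<close>. Its absolute value
  is at most \<open>s\<close>, so its fourth moment is at most \<open>s ^ 4\<close>, hence at most
  nine times the squared variance. This is the source of the constant 9.\<close>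

lemma expectation_uniform_centered:
  fixes s :: nat
  defines "U \<equiv> pmf_of_set {0..s}"
  shows "measure_pmf.expectation U (\<lambda>a. real s - 2 * real a) = 0"
    and "measure_pmf.expectation U (\<lambda>a. (real s - 2 * real a)\<^sup>2) = real s * (real s + 2) / 3"
    and "measure_pmf.expectation U (\<lambda>a. (real s - 2 * real a) ^ 4) \<le> 9 * (real s * (real s + 2) / 3)\<^sup>2"
proof -
  have E: "measure_pmf.expectation U f = (\<Sum>a=0..s. f a) / (real s + 1)" for f :: "nat \<Rightarrow> real"
    unfolding U_def by (subst integral_pmf_of_set) auto
  have s1: "(\<Sum>a=0..s. real a) = real s * (real s + 1) / 2"
    by (induction s) (auto simp: field_simps)
  have s2: "(\<Sum>a=0..s. (real a)\<^sup>2) = real s * (real s + 1) * (2 * real s + 1) / 6"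
    by (induction s) (auto simp: field_simps power2_eq_square)
  have "(\<Sum>a=0..s. real s - 2 * real a) = 0"
    using s1 by (simp add: sum_subtractf flip: sum_distrib_left) (simp add: algebra_simps)
  then show "measure_pmf.expectation U (\<lambda>a. real s - 2 * real a) = 0" by (simp add: E)
  have "(\<Sum>a=0..s. (real s - 2 * real a)\<^sup>2) = (\<Sum>a=0..s. (real s)\<^sup>2 - 4 * real s * real a + 4 * (real a)\<^sup>2)"
    by (intro sum.cong) (auto simp: power2_eq_square algebra_simps)
  also have "\<dots> = (real s + 1) * (real s)\<^sup>2 - 4 * real s * (\<Sum>a=0..s. real a) + 4 * (\<Sum>a=0..s. (real a)\<^sup>2)"
    by (simp add: sum.distrib sum_subtractf sum_distrib_left algebra_simps)
  also have "\<dots> = (real s * (real s + 2) / 3) * (real s + 1)"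
    unfolding s1 s2 by (simp add: power2_eq_square field_simps)
  finally show "measure_pmf.expectation U (\<lambda>a. (real s - 2 * real a)\<^sup>2) = real s * (real s + 2) / 3"
    by (simp add: E)
  have "(\<Sum>a=0..s. (real s - 2 * real a) ^ 4) \<le> (\<Sum>a=0..s. real s ^ 4)"
  proof (intro sum_mono)
    fix a assume "a \<in> {0..s}"
    then have "\<bar>real s - 2 * real a\<bar> \<le> real s" by auto
    then have "\<bar>real s - 2 * real a\<bar> ^ 4 \<le> real s ^ 4" by (intro power_mono) auto
    then show "(real s - 2 * real a) ^ 4 \<le> real s ^ 4" by simp
  qed
  also have "\<dots> = real s ^ 4 * (real s + 1)" by simp
  finally have "measure_pmf.expectation U (\<lambda>a. (real s - 2 * real a) ^ 4) \<le> real s ^ 4"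
    by (simp add: E field_simps)
  also have "\<dots> \<le> (real s * (real s + 2))\<^sup>2"
  proof -
    have "real s ^ 4 = (real s * real s)\<^sup>2" by (simp add: power4_eq_xxxx power2_eq_square)
    also have "\<dots> \<le> (real s * (real s + 2))\<^sup>2" by (intro power_mono mult_left_mono) auto
    finally show ?thesis .
  qed
  also have "\<dots> = 9 * (real s * (real s + 2) / 3)\<^sup>2" by (simp add: power_divide)
  finally show "measure_pmf.expectation U (\<lambda>a. (real s - 2 * real a) ^ 4) \<le> 9 * (real s * (real s + 2) / 3)\<^sup>2" .
qed

text \<open>The law of \<open>a\<close> given \<open>D\<close> and the sums \<open>s\<close>. The
  default 0 outside \<open>{1..D}\<close> agrees with \<open>durfee_triples\<close>.\<close>

definition box_pmf :: "nat \<Rightarrow> (nat \<Rightarrow> nat) \<Rightarrow> (nat \<Rightarrow> nat) pmf" where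
  "box_pmf D s = Pi_pmf {1..D} 0 (\<lambda>j. pmf_of_set {0..s j})"

text \<open>The variance of \<open>s - 2 * a\<close> for \<open>a\<close> uniform on
  \<open>{0..s}\<close>.\<close>

definition unif_var :: "nat \<Rightarrow> real" where
  "unif_var s = real s * (real s + 2) / 3"

lemma finite_set_box_pmf: "finite (set_pmf (box_pmf D s))"
  unfolding box_pmf_def by (subst set_Pi_pmf) (auto intro!: finite_PiE_dflt)

lemma box_sum_moments:
  fixes s :: "nat \<Rightarrow> nat" and w :: "nat \<Rightarrow> real"
  assumes "B \<subseteq> {1..D}"
  defines "S \<equiv> \<lambda>f. \<Sum>j\<in>B. w j * (real (s j) - 2 * real (f j))"
  defines "V \<equiv> \<Sum>j\<in>B. (w j)\<^sup>2 * unif_var (s j)"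
  shows "measure_pmf.expectation (box_pmf D s) S = 0"
    and "measure_pmf.expectation (box_pmf D s) (\<lambda>f. (S f)\<^sup>2) = V"
    and "measure_pmf.expectation (box_pmf D s) (\<lambda>f. S f ^ 4) \<le> 9 * V\<^sup>2"
proof -
  let ?P = "box_pmf D s"
  note ps = measure_pmf.prob_space_axioms[of ?P]
  let ?E = "measure_pmf.expectation ?P"
  define X where "X = (\<lambda>j f. w j * (real (s j) - 2 * real (f j :: nat)))"
  have comp: "?E (\<lambda>f. h (f j)) = measure_pmf.expectation (pmf_of_set {0..s j}) h"
    if "j \<in> {1..D}" for j and h :: "nat \<Rightarrow> real"
  proof -
    have "?E (\<lambda>f. h (f j)) = measure_pmf.expectation (map_pmf (\<lambda>f. f j) ?P) h" by simp
    also have "map_pmf (\<lambda>f. f j) ?P = pmf_of_set {0..s j}"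
      unfolding box_pmf_def using that by (subst Pi_pmf_component) auto
    finally show ?thesis .
  qed
  have ind: "prob_space.indep_vars (measure_pmf ?P) (\<lambda>_. borel) X {1..D}"
    unfolding box_pmf_def X_def
    by (intro prob_space.indep_vars_compose2[OF _ indep_vars_Pi_pmf, where Y = "\<lambda>j a. w j * (real (s j) - 2 * real a)"])
       (auto simp: measure_pmf.prob_space_axioms)
  have indB: "prob_space.indep_vars (measure_pmf ?P) (\<lambda>_. borel) X B"
    using ind assms(1) by (rule prob_space.indep_vars_subset[OF ps])
  have finB: "finite B" using assms(1) finite_subset by blast
  have e1: "?E (X j) = 0" if "j \<in> B" for j
    using comp[of j "\<lambda>a. w j * (real (s j) - 2 * real a)"] expectation_uniform_centered(1)[of "s j"] that assms(1)
    by (auto simp: X_def)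
  have e2: "?E (\<lambda>f. (X j f)\<^sup>2) = (w j)\<^sup>2 * unif_var (s j)" if "j \<in> B" for j
    using comp[of j "\<lambda>a. (w j * (real (s j) - 2 * real a))\<^sup>2"] expectation_uniform_centered(2)[of "s j"] that assms(1)
    by (auto simp: X_def power_mult_distrib unif_var_def)
  have e4: "?E (\<lambda>f. X j f ^ 4) \<le> 9 * (?E (\<lambda>f. (X j f)\<^sup>2))\<^sup>2" if "j \<in> B" for j
  proof -
    have "?E (\<lambda>f. X j f ^ 4) = w j ^ 4 * measure_pmf.expectation (pmf_of_set {0..s j}) (\<lambda>a. (real (s j) - 2 * real a) ^ 4)"
      using comp[of j "\<lambda>a. (w j * (real (s j) - 2 * real a)) ^ 4"] that assms(1)
      by (auto simp: X_def power_mult_distrib)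
    also have "\<dots> \<le> w j ^ 4 * (9 * (unif_var (s j))\<^sup>2)"
      unfolding unif_var_def using expectation_uniform_centered(3)[of "s j"] by (intro mult_left_mono) auto
    also have "\<dots> = 9 * ((w j)\<^sup>2 * unif_var (s j))\<^sup>2" by (simp add: power_mult_distrib)
    finally show ?thesis using e2[OF that] by simp
  qed
  note m = indep_sum_moments[OF finite_set_box_pmf finB indB e1 e4]
  have SX: "S = (\<lambda>f. \<Sum>j\<in>B. X j f)" by (simp add: S_def X_def)
  have VX: "V = (\<Sum>j\<in>B. ?E (\<lambda>f. (X j f)\<^sup>2))" using e2 by (simp add: V_def)
  show "?E S = 0" "?E (\<lambda>f. (S f)\<^sup>2) = V" "?E (\<lambda>f. S f ^ 4) \<le> 9 * V\<^sup>2"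
    unfolding SX VX using m by blast+
qed

text \<open>Split each sum into its block \<open>B i\<close> and a remainder, with a tenth of the
  block's standard deviation as threshold \<open>c i\<close>. By Chebyshev a remainder reaches
  \<open>c i\<close> with probability at most \<open>100 * \<eta>\<close>. If none does and all sums
  are nonnegative, every block sum is at least \<open>- c i\<close>. These events are independent
  and have probability at most \<open>39 / 40\<close> each.\<close>

lemma box_persistence:
  fixes \<eta> :: real and s :: "nat \<Rightarrow> nat" and w :: "'i \<Rightarrow> nat \<Rightarrow> real"
  assumes I: "finite I" "disjoint_family_on B I" "\<And>i. i \<in> I \<Longrightarrow> B i \<subseteq> {1..D}"
    and pos: "\<And>i. i \<in> I \<Longrightarrow> 0 < (\<Sum>j\<in>B i. (w i j)\<^sup>2 * unif_var (s j))"
    and dom: "\<And>i. i \<in> I \<Longrightarrow> (\<Sum>j\<in>{1..D} - B i. (w i j)\<^sup>2 * unif_var (s j))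
                \<le> \<eta> * (\<Sum>j\<in>B i. (w i j)\<^sup>2 * unif_var (s j))"
  shows "measure_pmf.prob (box_pmf D s) {f. \<forall>i\<in>I. 0 \<le> (\<Sum>j=1..D. w i j * (real (s j) - 2 * real (f j)))}
           \<le> (39 / 40) ^ card I + 100 * \<eta> * card I"
proof -
  let ?P = "box_pmf D s"
  note ps = measure_pmf.prob_space_axioms[of ?P]
  let ?T = "\<lambda>A i f. \<Sum>j\<in>A. w i j * (real (s j) - 2 * real (f j :: nat))"
  define v where "v = (\<lambda>i. \<Sum>j\<in>B i. (w i j)\<^sup>2 * unif_var (s j))"
  define c where "c = (\<lambda>i. sqrt (v i) / 10)"
  have vpos: "0 < v i" if "i \<in> I" for i using pos that by (simp add: v_def)
  have cpos: "0 < c i" if "i \<in> I" for i using vpos[OF that] by (simp add: c_def)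
  have far: "measure_pmf.prob ?P {f. c i \<le> \<bar>?T ({1..D} - B i) i f\<bar>} \<le> 100 * \<eta>" if i: "i \<in> I" for i
  proof -
    note m = box_sum_moments[of "{1..D} - B i" D s "w i"]
    have "measure_pmf.prob ?P {f \<in> space (measure_pmf ?P). c i \<le> \<bar>?T ({1..D} - B i) i f\<bar>}
        \<le> measure_pmf.expectation ?P (\<lambda>f. (?T ({1..D} - B i) i f)\<^sup>2) / (c i)\<^sup>2"
      using cpos[OF i] by (intro measure_pmf.second_moment_method integrable_measure_pmf_finite finite_set_box_pmf) auto
    also have "\<dots> = (\<Sum>j\<in>{1..D} - B i. (w i j)\<^sup>2 * unif_var (s j)) / (v i / 100)"
      using m(2) vpos[OF i] by (simp add: c_def power_divide)
    also have "\<dots> \<le> (\<eta> * v i) / (v i / 100)"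
      using dom[OF i] vpos[OF i] unfolding v_def by (intro divide_right_mono) auto
    also have "\<dots> = 100 * \<eta>" using vpos[OF i] by simp
    finally show ?thesis by simp
  qed
  have near: "measure_pmf.prob ?P {f. - c i \<le> ?T (B i) i f} \<le> 39 / 40" if i: "i \<in> I" for i
  proof -
    note m = box_sum_moments[OF I(3)[OF i], of s "w i"]
    have "1 / 40 \<le> measure_pmf.prob ?P {f. ?T (B i) i f < - c i}"
      unfolding c_def using vpos[OF i] m unfolding v_def
      by (intro prob_less_neg_ge finite_set_box_pmf) auto
    moreover have "measure_pmf.prob ?P {f. - c i \<le> ?T (B i) i f} = 1 - measure_pmf.prob ?P {f. ?T (B i) i f < - c i}"
      using measure_pmf.prob_compl[of "{f. ?T (B i) i f < - c i}" ?P]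
      by (simp add: not_less Compl_eq_Diff_UNIV[symmetric] Collect_neg_eq[symmetric])
    ultimately show ?thesis by simp
  qed
  have all: "measure_pmf.prob ?P {f. \<forall>i\<in>I. - c i \<le> ?T (B i) i f} \<le> (39 / 40) ^ card I"
  proof (cases "I = {}")
    case False
    \<comment> \<open>Restricting \<open>f\<close> to \<open>B i\<close> presents each block sum as
      a function of its own coordinates, so disjoint blocks give independence.\<close>
    have "prob_space.indep_vars (measure_pmf ?P) (\<lambda>i. PiM (B i) (\<lambda>_. count_space UNIV)) (\<lambda>i f. restrict (\<lambda>j. f j) (B i)) I"
      unfolding box_pmf_def
      by (rule prob_space.indep_vars_restrict[OF measure_pmf.prob_space_axioms indep_vars_Pi_pmf]) (use I in auto)
    then have "prob_space.indep_vars (measure_pmf ?P) (\<lambda>_. borel) (\<lambda>i f. ?T (B i) i (restrict (\<lambda>j. f j) (B i))) I"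
      by (rule prob_space.indep_vars_compose2[OF ps]) measurable
    then have "measure_pmf.prob ?P (\<Inter>i\<in>I. (\<lambda>f. ?T (B i) i (restrict (\<lambda>j. f j) (B i))) -` {- c i..} \<inter> space ?P)
        = (\<Prod>i\<in>I. measure_pmf.prob ?P ((\<lambda>f. ?T (B i) i (restrict (\<lambda>j. f j) (B i))) -` {- c i..} \<inter> space ?P))"
      using False I(1) by (intro prob_space.indep_varsD_finite[OF ps]) auto
    also have "\<dots> = (\<Prod>i\<in>I. measure_pmf.prob ?P {f. - c i \<le> ?T (B i) i f})"
      by (intro prod.cong refl arg_cong[of _ _ "measure_pmf.prob ?P"]) auto
    also have "\<dots> \<le> (\<Prod>i\<in>I. 39 / 40)"
      using near by (intro prod_mono) auto
    also have "(\<Inter>i\<in>I. (\<lambda>f. ?T (B i) i (restrict (\<lambda>j. f j) (B i))) -` {- c i..} \<inter> space ?P)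
        = {f. \<forall>i\<in>I. - c i \<le> ?T (B i) i f}"
      using False by auto
    finally show ?thesis by simp
  qed simp
  have "{f. \<forall>i\<in>I. 0 \<le> ?T {1..D} i f}
      \<subseteq> {f. \<forall>i\<in>I. - c i \<le> ?T (B i) i f} \<union> (\<Union>i\<in>I. {f. c i \<le> \<bar>?T ({1..D} - B i) i f\<bar>})"
  proof safe
    fix f i
    assume f: "\<forall>i\<in>I. 0 \<le> ?T {1..D} i f" and n: "f \<notin> (\<Union>i\<in>I. {f. c i \<le> \<bar>?T ({1..D} - B i) i f\<bar>})" and i: "i \<in> I"
    have "?T {1..D} i f = ?T ({1..D} - B i) i f + ?T (B i) i f"
      using I(3)[OF i] by (intro sum.subset_diff) auto
    moreover have "\<bar>?T ({1..D} - B i) i f\<bar> < c i" using n i by (auto simp: not_le)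
    moreover have "0 \<le> ?T {1..D} i f" using f i by blast
    ultimately show "- c i \<le> ?T (B i) i f" by linarith
  qed
  then have "measure_pmf.prob ?P {f. \<forall>i\<in>I. 0 \<le> ?T {1..D} i f}
      \<le> measure_pmf.prob ?P ({f. \<forall>i\<in>I. - c i \<le> ?T (B i) i f} \<union> (\<Union>i\<in>I. {f. c i \<le> \<bar>?T ({1..D} - B i) i f\<bar>}))"
    by (intro measure_pmf.finite_measure_mono) auto
  also have "\<dots> \<le> measure_pmf.prob ?P {f. \<forall>i\<in>I. - c i \<le> ?T (B i) i f}
      + measure_pmf.prob ?P (\<Union>i\<in>I. {f. c i \<le> \<bar>?T ({1..D} - B i) i f\<bar>})"
    by (intro measure_Un_le) auto
  also have "measure_pmf.prob ?P (\<Union>i\<in>I. {f. c i \<le> \<bar>?T ({1..D} - B i) i f\<bar>})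
      \<le> (\<Sum>i\<in>I. measure_pmf.prob ?P {f. c i \<le> \<bar>?T ({1..D} - B i) i f\<bar>})"
    using I(1) by (intro measure_UNION_le) auto
  also have "\<dots> \<le> (\<Sum>i\<in>I. 100 * \<eta>)" using far by (intro sum_mono) auto
  finally show ?thesis using all by (simp add: algebra_simps)
qed

section \<open>Multiplicities around the Durfee square\<close>

lemma finite_durfee_triples: "finite (durfee_triples n)"
  using bij_betw_finite[OF bij_betw_of_durfee] finite_partitions by blast

lemma sum_durfee_triples: "(\<Sum>t\<in>durfee_triples n. h (of_durfee t)) = (\<Sum>\<pi>\<in>partitions n. h \<pi>)"
  by (rule sum.reindex_bij_betw[OF bij_betw_of_durfee])

lemma card_durfee_triples_of:
  "card {t \<in> durfee_triples n. Q (of_durfee t)} = card {\<pi> \<in> partitions n. Q \<pi>}"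
proof -
  have "bij_betw of_durfee {t \<in> durfee_triples n. Q (of_durfee t)} {\<pi> \<in> partitions n. Q \<pi>}"
    using bij_betw_of_durfee[of n] unfolding bij_betw_def by (auto simp: inj_on_def)
  then show ?thesis by (rule bij_betw_same_card)
qed

text \<open>\<open>b j\<close> is at most the multiplicity of \<open>j\<close>, and
  \<open>a j\<close> has the same second moment by symmetry. The square of a sum is at most twice
  the sum of the squares, whence 192 = 4 * 48.\<close>

lemma durfee_triples_second_moment:
  assumes "n \<le> J\<^sup>2" "0 < J" "0 < j"
  shows "(\<Sum>(D, a, b)\<in>durfee_triples n. (real j * real (a j + b j))\<^sup>2) \<le> 192 * real J ^ 2 * card (partitions n)"
proof -
  let ?T = "durfee_triples n"
  have b: "(\<Sum>(D, a, b)\<in>?T. (real j * real (b j))\<^sup>2) \<le> 48 * real J ^ 2 * card (partitions n)"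
  proof -
    have "(\<Sum>(D, a, b)\<in>?T. (real j * real (b j))\<^sup>2) \<le> (\<Sum>t\<in>?T. (real j * real (count (of_durfee t) j))\<^sup>2)"
    proof (intro sum_mono, clarify)
      fix D a b assume t: "(D, a, b) \<in> ?T"
      have "b j \<le> count (of_durfee (D, a, b)) j"
      proof (cases "j \<in> {1..D}")
        case True
        then show ?thesis by (rule count_of_durfee)
      next
        case False
        then show ?thesis using t by (auto simp: durfee_triples_def)
      qed
      then show "(real j * real (b j))\<^sup>2 \<le> (real j * real (count (of_durfee (D, a, b)) j))\<^sup>2"
        by (intro power_mono mult_left_mono) auto
    qed
    also have "\<dots> = (\<Sum>\<pi>\<in>partitions n. (real j * real (count \<pi> j))\<^sup>2)"
      by (rule sum_durfee_triples)
    also have "\<dots> \<le> 48 * real J ^ 2 * card (partitions n)"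
      by (rule partitions_count_second_moment[OF assms])
    finally show ?thesis .
  qed
  \<comment> \<open>Conjugation of the diagram.\<close>
  have "bij_betw (\<lambda>(D, a, b). (D, b, a)) ?T ?T"
    by (rule bij_betw_byWitness[where f' = "\<lambda>(D, a, b). (D, b, a)"])
       (auto simp: durfee_triples_def add.commute)
  from sum.reindex_bij_betw[OF this, of "\<lambda>(D, a, b). (real j * real (b j))\<^sup>2"]
  have a: "(\<Sum>(D, a, b)\<in>?T. (real j * real (a j))\<^sup>2) = (\<Sum>(D, a, b)\<in>?T. (real j * real (b j))\<^sup>2)"
    by (simp add: case_prod_beta)
  have "(\<Sum>(D, a, b)\<in>?T. (real j * real (a j + b j))\<^sup>2)
      \<le> (\<Sum>(D, a, b)\<in>?T. 2 * (real j * real (a j))\<^sup>2 + 2 * (real j * real (b j))\<^sup>2)"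
  proof (intro sum_mono, clarify)
    fix a b :: "nat \<Rightarrow> nat"
    have "0 \<le> (real j * real (a j) - real j * real (b j))\<^sup>2" by simp
    then show "(real j * real (a j + b j))\<^sup>2 \<le> 2 * (real j * real (a j))\<^sup>2 + 2 * (real j * real (b j))\<^sup>2"
      by (simp add: power2_eq_square algebra_simps)
  qed
  also have "\<dots> = 2 * (\<Sum>(D, a, b)\<in>?T. (real j * real (a j))\<^sup>2) + 2 * (\<Sum>(D, a, b)\<in>?T. (real j * real (b j))\<^sup>2)"
    by (simp add: case_prod_beta sum.distrib sum_distrib_left)
  finally show ?thesis using a b by simp
qed

lemma unif_var_bounds: "(real s)\<^sup>2 / 3 \<le> unif_var s" "unif_var s \<le> (real s)\<^sup>2" "0 \<le> unif_var s"
proof -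
  show "(real s)\<^sup>2 / 3 \<le> unif_var s" by (simp add: unif_var_def power2_eq_square algebra_simps)
  show "0 \<le> unif_var s" by (simp add: unif_var_def)
  have "s \<le> s * s" by simp
  then have "real s \<le> real s * real s" by (metis of_nat_le_iff of_nat_mult)
  then show "unif_var s \<le> (real s)\<^sup>2" by (simp add: unif_var_def power2_eq_square algebra_simps)
qed

text \<open>The terms are dominated by the telescoping differences of \<open>1 / j\<close>.\<close>

lemma sum_inverse_squares_le:
  assumes "0 < h"
  shows "(\<Sum>j\<in>{h<..n}. 1 / (real j)\<^sup>2) \<le> 1 / real h"
proof (cases "h \<le> n")
  case True
  then have "(\<Sum>j\<in>{h<..n}. 1 / (real j)\<^sup>2) \<le> 1 / real h - 1 / real n"
  proof (induction n rule: dec_induct)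
    case (step n)
    have "{h<..Suc n} = insert (Suc n) {h<..n}" using step by auto
    then have "(\<Sum>j\<in>{h<..Suc n}. 1 / (real j)\<^sup>2) \<le> 1 / (real (Suc n))\<^sup>2 + (1 / real h - 1 / real n)"
      using step by simp
    also have "1 / (real (Suc n))\<^sup>2 \<le> 1 / (real n * real (Suc n))"
      using step.hyps assms unfolding power2_eq_square
      by (intro divide_left_mono mult_right_mono mult_pos_pos) auto
    also have "1 / (real n * real (Suc n)) = 1 / real n - 1 / real (Suc n)"
      using step.hyps assms by (simp add: field_simps)
    finally show ?case by simp
  qed simp
  then show ?thesis by (simp add: order_trans)
qed simp

text \<open>The variance of the part with indices in \<open>A\<close> of the sum that belongs to \<open>k\<close>.\<close>

definition block_var :: "nat \<Rightarrow> (nat \<Rightarrow> nat) \<Rightarrow> nat set \<Rightarrow> real" where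
  "block_var k s A = (\<Sum>j\<in>A. (real (min j k))\<^sup>2 * unif_var (s j))"

lemma block_var_mono: "finite B \<Longrightarrow> A \<subseteq> B \<Longrightarrow> block_var k s A \<le> block_var k s B"
  unfolding block_var_def by (intro sum_mono2) (auto simp: unif_var_bounds)

text \<open>Each term is a factor \<open>(min j k / j)\<^sup>2\<close> times the square of
  \<open>j * (a j + b j)\<close>, whose sum over the triples is bounded uniformly in
  \<open>j\<close>. The factor is at most 1 for \<open>j \<le> l\<close> and at most
  \<open>k\<^sup>2 / j\<^sup>2\<close> for \<open>j > h\<close>, which sums to
  \<open>l + k\<^sup>2 / h\<close>.\<close>

lemma sum_far_block_var_le:
  assumes J: "n \<le> J\<^sup>2" "0 < J" and h: "0 < h"
  shows "(\<Sum>(D, a, b)\<in>durfee_triples n. block_var k (\<lambda>j. a j + b j) ({1..D} - {l<..h}))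
      \<le> 192 * real J ^ 2 * card (partitions n) * (real l + (real k)\<^sup>2 / real h)"
proof -
  let ?T = "durfee_triples n"
  let ?C = "192 * real J ^ 2 * card (partitions n)"
  let ?g = "\<lambda>j. (real (min j k) / real j)\<^sup>2"
  have "(\<Sum>(D, a, b)\<in>?T. block_var k (\<lambda>j. a j + b j) ({1..D} - {l<..h}))
     \<le> (\<Sum>(D, a, b)\<in>?T. \<Sum>j\<in>{1..n} - {l<..h}. ?g j * (real j * real (a j + b j))\<^sup>2)"
  proof (intro sum_mono, clarify)
    fix D a b assume "(D, a, b) \<in> ?T"
    then have "D\<^sup>2 \<le> n" by (auto simp: durfee_triples_def)
    then have D: "D \<le> n" by (meson le_trans power2_nat_le_imp_le le_refl)
    have "block_var k (\<lambda>j. a j + b j) ({1..D} - {l<..h}) \<le> block_var k (\<lambda>j. a j + b j) ({1..n} - {l<..h})"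
      using D by (intro block_var_mono) auto
    also have "\<dots> \<le> (\<Sum>j\<in>{1..n} - {l<..h}. ?g j * (real j * real (a j + b j))\<^sup>2)"
      unfolding block_var_def
    proof (intro sum_mono)
      fix j assume "j \<in> {1..n} - {l<..h}"
      then have "?g j * (real j * real (a j + b j))\<^sup>2 = (real (min j k))\<^sup>2 * (real (a j + b j))\<^sup>2"
        by (simp add: power_divide power_mult_distrib)
      then show "(real (min j k))\<^sup>2 * unif_var (a j + b j) \<le> ?g j * (real j * real (a j + b j))\<^sup>2"
        using unif_var_bounds(2)[of "a j + b j"] by (simp add: mult_left_mono)
    qed
    finally show "block_var k (\<lambda>j. a j + b j) ({1..D} - {l<..h})
        \<le> (\<Sum>j\<in>{1..n} - {l<..h}. ?g j * (real j * real (a j + b j))\<^sup>2)" .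
  qed
  also have "\<dots> = (\<Sum>j\<in>{1..n} - {l<..h}. ?g j * (\<Sum>(D, a, b)\<in>?T. (real j * real (a j + b j))\<^sup>2))"
    unfolding case_prod_beta by (subst sum.swap) (simp add: sum_distrib_left)
  also have "\<dots> \<le> (\<Sum>j\<in>{1..n} - {l<..h}. ?g j * ?C)"
    using J by (intro sum_mono mult_left_mono durfee_triples_second_moment) auto
  also have "\<dots> = ?C * (\<Sum>j\<in>{1..n} - {l<..h}. ?g j)" by (simp add: sum_distrib_left mult.commute)
  also have "\<dots> \<le> ?C * (real l + (real k)\<^sup>2 / real h)"
  proof (intro mult_left_mono)
    have "(\<Sum>j\<in>{1..n} - {l<..h}. ?g j) \<le> (\<Sum>j\<in>{1..l} \<union> {h<..n}. ?g j)"
      by (intro sum_mono2) auto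
    also have "\<dots> \<le> (\<Sum>j\<in>{1..l}. ?g j) + (\<Sum>j\<in>{h<..n}. ?g j)"
    proof -
      have "(\<Sum>j\<in>{1..l} \<union> {h<..n}. ?g j) + (\<Sum>j\<in>{1..l} \<inter> {h<..n}. ?g j) = (\<Sum>j\<in>{1..l}. ?g j) + (\<Sum>j\<in>{h<..n}. ?g j)"
        by (rule sum.union_inter) auto
      moreover have "0 \<le> (\<Sum>j\<in>{1..l} \<inter> {h<..n}. ?g j)" by (intro sum_nonneg) auto
      ultimately show ?thesis by linarith
    qed
    also have "(\<Sum>j\<in>{1..l}. ?g j) \<le> (\<Sum>j\<in>{1..l}. 1)"
      by (intro sum_mono) (auto simp: power_le_one)
    also have "(\<Sum>j\<in>{h<..n}. ?g j) \<le> (\<Sum>j\<in>{h<..n}. (real k)\<^sup>2 * (1 / (real j)\<^sup>2))"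
      by (intro sum_mono) (auto simp: power_divide intro!: divide_right_mono power_mono)
    also have "\<dots> \<le> (real k)\<^sup>2 * (1 / real h)"
      unfolding sum_distrib_left[symmetric] using sum_inverse_squares_le[OF h] by (intro mult_left_mono) auto
    finally show "(\<Sum>j\<in>{1..n} - {l<..h}. ?g j) \<le> real l + (real k)\<^sup>2 / real h" by simp
  qed auto
  finally show ?thesis .
qed

lemma card_ge_markov:
  fixes f :: "'a \<Rightarrow> real"
  assumes "finite A" "\<And>x. x \<in> A \<Longrightarrow> 0 \<le> f x" "0 < c" "(\<Sum>x\<in>A. f x) \<le> c * e"
  shows "real (card {x \<in> A. c \<le> f x}) \<le> e"
proof -
  have "c * real (card {x \<in> A. c \<le> f x}) = (\<Sum>x\<in>{x \<in> A. c \<le> f x}. c)" by simp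
  also have "\<dots> \<le> (\<Sum>x\<in>{x \<in> A. c \<le> f x}. f x)" by (intro sum_mono) auto
  also have "\<dots> \<le> (\<Sum>x\<in>A. f x)" using assms by (intro sum_mono2) auto
  finally have "c * real (card {x \<in> A. c \<le> f x}) \<le> c * e" using assms(4) by linarith
  then show ?thesis using assms(3) by simp
qed

text \<open>At least half of the \<open>k\<close> indices have multiplicity at least
  \<open>r\<close>, and each of these contributes at least \<open>k\<^sup>2 * r\<^sup>2 / 3\<close>.
  They lie below \<open>D\<close>, where the multiplicity of \<open>j\<close> is
  \<open>b j\<close>.\<close>

lemma near_block_var_ge:
  assumes few: "real (card {j \<in> {k<..2 * k}. count (of_durfee (D, a, b)) j < r}) < real k / 2"
    and D: "2 * k < D"
  shows "(real k) ^ 3 * (real r)\<^sup>2 / 6 \<le> block_var k (\<lambda>j. a j + b j) {k<..2 * k}"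
proof -
  let ?bad = "{j \<in> {k<..2 * k}. count (of_durfee (D, a, b)) j < r}"
  have "real k / 2 \<le> real (card ({k<..2 * k} - ?bad))"
    using few by (subst card_Diff_subset) (auto simp: of_nat_diff card_mono)
  then have "(real k / 2) * ((real k)\<^sup>2 * ((real r)\<^sup>2 / 3)) \<le> real (card ({k<..2 * k} - ?bad)) * ((real k)\<^sup>2 * ((real r)\<^sup>2 / 3))"
    by (intro mult_right_mono) auto
  also have "\<dots> = (\<Sum>j\<in>{k<..2 * k} - ?bad. (real k)\<^sup>2 * ((real r)\<^sup>2 / 3))" by simp
  also have "\<dots> \<le> block_var k (\<lambda>j. a j + b j) ({k<..2 * k} - ?bad)"
    unfolding block_var_def
  proof (intro sum_mono mult_mono)
    fix j assume j: "j \<in> {k<..2 * k} - ?bad"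
    then have "count (of_durfee (D, a, b)) j = b j" using D by (intro count_of_durfee) auto
    then have "(real r)\<^sup>2 \<le> (real (a j + b j))\<^sup>2" using j by (intro power_mono) auto
    then show "(real r)\<^sup>2 / 3 \<le> unif_var (a j + b j)" using unif_var_bounds(1)[of "a j + b j"] by linarith
  qed auto
  also have "\<dots> \<le> block_var k (\<lambda>j. a j + b j) {k<..2 * k}"
    by (intro block_var_mono) auto
  finally show ?thesis by (simp add: power2_eq_square power3_eq_cube)
qed

text \<open>Membership in \<open>durfee_triples n\<close> depends only on \<open>D\<close> and the
  sums \<open>s\<close>. With these fixed, \<open>a\<close> ranges over the whole box
  \<open>a j \<le> s j\<close>, so uniform counting on the fibre is \<open>box_pmf D s\<close>. As
  \<open>good\<close> is constant on fibres, the bound for each good fibre adds up.\<close>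

lemma card_fibrewise_le:
  fixes \<epsilon> :: real
  assumes "\<And>D s. good D s \<Longrightarrow> measure_pmf.prob (box_pmf D s) {f. cond D s f} \<le> \<epsilon>" "0 \<le> \<epsilon>"
  shows "real (card {(D, a, b) \<in> durfee_triples n. good D (\<lambda>j. a j + b j) \<and> cond D (\<lambda>j. a j + b j) a})
      \<le> \<epsilon> * card (durfee_triples n)"
proof -
  let ?T = "durfee_triples n"
  define \<phi> where "\<phi> = (\<lambda>(D, a, b). (D :: nat, \<lambda>j :: nat. a j + b j :: nat))"
  define h where "h = (\<lambda>(D, a, b). of_bool (good D (\<lambda>j. a j + b j) \<and> cond D (\<lambda>j. a j + b j) a) :: real)"
  have "real (card {(D, a, b) \<in> ?T. good D (\<lambda>j. a j + b j) \<and> cond D (\<lambda>j. a j + b j) a}) = (\<Sum>t\<in>?T. h t)"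
  proof -
    have "(\<Sum>t\<in>?T. h t) = (\<Sum>t\<in>{(D, a, b) \<in> ?T. good D (\<lambda>j. a j + b j) \<and> cond D (\<lambda>j. a j + b j) a}. 1)"
      using finite_durfee_triples by (intro sum.mono_neutral_cong_right) (auto simp: h_def)
    then show ?thesis by simp
  qed
  also have "\<dots> = (\<Sum>y\<in>\<phi> ` ?T. \<Sum>t\<in>{t \<in> ?T. \<phi> t = y}. h t)"
    by (rule sum.image_gen[OF finite_durfee_triples])
  also have "\<dots> \<le> (\<Sum>y\<in>\<phi> ` ?T. \<Sum>t\<in>{t \<in> ?T. \<phi> t = y}. \<epsilon>)"
  proof (rule sum_mono)
    fix y assume "y \<in> \<phi> ` ?T"
    then obtain D a0 b0 where t0: "(D, a0, b0) \<in> ?T" "y = \<phi> (D, a0, b0)" by auto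
    define s where "s = (\<lambda>j. a0 j + b0 j)"
    have y: "y = (D, s)" by (simp add: t0 \<phi>_def s_def)
    let ?box = "PiE_dflt {1..D} 0 (\<lambda>j. {0..s j})"
    have s0: "s j = 0" if "j \<notin> {1..D}" for j using t0 that by (auto simp: durfee_triples_def s_def)
    have bij: "bij_betw (\<lambda>f. (D, f, \<lambda>j. s j - f j)) ?box {t \<in> ?T. \<phi> t = y}"
    proof (rule bij_betw_byWitness[where f' = "\<lambda>(D, a, b). a"])
      show "(\<lambda>f. (D, f, \<lambda>j. s j - f j)) ` ?box \<subseteq> {t \<in> ?T. \<phi> t = y}"
      proof (intro image_subsetI CollectI conjI)
        fix f assume f: "f \<in> ?box"
        have fs: "f j \<le> s j" for j using f s0 by (cases "j \<in> {1..D}") (auto simp: PiE_dflt_def)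
        then have "(\<lambda>j. f j + (s j - f j)) = s" by auto
        then show "\<phi> (D, f, \<lambda>j. s j - f j) = y" by (simp add: \<phi>_def y)
        have "(\<Sum>j=1..D. j * (f j + (s j - f j))) = (\<Sum>j=1..D. j * (a0 j + b0 j))"
          using fs by (intro sum.cong) (auto simp: s_def)
        then show "(D, f, \<lambda>j. s j - f j) \<in> ?T"
          using t0(1) f s0 by (auto simp: durfee_triples_def PiE_dflt_def)
      qed
      show "\<forall>t\<in>{t \<in> ?T. \<phi> t = y}. (\<lambda>f. (D, f, \<lambda>j. s j - f j)) (case t of (D, a, b) \<Rightarrow> a) = t"
        by (auto simp: y \<phi>_def)
      show "(\<lambda>(D, a, b). a) ` {t \<in> ?T. \<phi> t = y} \<subseteq> ?box"
        by (auto simp: y \<phi>_def PiE_dflt_def durfee_triples_def)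
    qed auto
    have finbox: "finite ?box" "?box \<noteq> {}" by (auto intro!: finite_PiE_dflt)
    have cf: "card {t \<in> ?T. \<phi> t = y} = card ?box" using bij by (simp add: bij_betw_same_card)
    have sum_box: "(\<Sum>t\<in>{t \<in> ?T. \<phi> t = y}. h t) = (\<Sum>f\<in>?box. h (D, f, \<lambda>j. s j - f j))"
      using sum.reindex_bij_betw[OF bij, of h] by simp
    also have "\<dots> = (\<Sum>f\<in>?box. of_bool (good D s \<and> cond D s f))"
    proof (intro sum.cong refl)
      fix f assume f: "f \<in> ?box"
      have fs: "f j \<le> s j" for j using f s0 by (cases "j \<in> {1..D}") (auto simp: PiE_dflt_def)
      then have "(\<lambda>j. f j + (s j - f j)) = s" by auto
      then show "h (D, f, \<lambda>j. s j - f j) = of_bool (good D s \<and> cond D s f)" by (simp add: h_def)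
    qed
    also have "\<dots> \<le> \<epsilon> * card ?box"
    proof (cases "good D s")
      case True
      have "box_pmf D s = pmf_of_set ?box" unfolding box_pmf_def by (intro Pi_pmf_of_set) auto
      then have "measure_pmf.prob (box_pmf D s) {f. cond D s f} = real (card (?box \<inter> {f. cond D s f})) / card ?box"
        using finbox by (simp add: measure_pmf_of_set)
      then have "real (card (?box \<inter> {f. cond D s f})) / card ?box \<le> \<epsilon>" using assms(1)[OF True] by simp
      moreover have "(\<Sum>f\<in>?box. of_bool (good D s \<and> cond D s f)) = real (card (?box \<inter> {f. cond D s f}))"
        using True finbox by simp
      moreover have "0 < card ?box" using finbox by (simp add: card_gt_0_iff)
      ultimately show ?thesis by (simp add: field_simps)
    qed (use assms(2) in simp)
    finally show "(\<Sum>t\<in>{t \<in> ?T. \<phi> t = y}. h t) \<le> (\<Sum>t\<in>{t \<in> ?T. \<phi> t = y}. \<epsilon>)"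
      using cf by (simp add: mult.commute)
  qed
  also have "\<dots> = (\<Sum>t\<in>?T. \<epsilon>)"
    by (rule sum.image_gen[OF finite_durfee_triples, symmetric])
  finally show ?thesis by (simp add: mult.commute)
qed

section \<open>The probability of being graphical\<close>

lemma half_le_nat_floor:
  fixes x :: real
  assumes "1 \<le> x"
  shows "x / 2 \<le> real (nat \<lfloor>x\<rfloor>)"
proof -
  have "1 \<le> \<lfloor>x\<rfloor>" using assms by simp
  then have "1 \<le> real_of_int \<lfloor>x\<rfloor>" "real (nat \<lfloor>x\<rfloor>) = real_of_int \<lfloor>x\<rfloor>" by simp_all
  moreover have "x < real_of_int \<lfloor>x\<rfloor> + 1" by (rule real_of_int_floor_add_one_gt)
  ultimately show ?thesis by linarith
qed

text \<open>With \<open>x = ln n\<close>, this compares the variance allowed outside a window with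
  the variance guaranteed inside; 36864 = 24 * 1536.\<close>

lemma scale_ratio_eq:
  fixes x :: real
  assumes "x \<noteq> 0"
  shows "1536 * L * x * n * k / x ^ 8 = 36864 * L / x ^ 3 * (k * n / (24 * x ^ 4))"
  using assms by (simp add: field_simps eval_nat_numeral)

text \<open>The first two summands bound the good triples by \<open>box_persistence\<close> with
  \<open>L\<close> scales. The other three account for a large variance outside some window, for
  many small multiplicities near some scale, and for a small Durfee square.\<close>

lemma card_graphical_le:
  fixes n L R :: nat
  assumes cnt: "\<And>j r. 0 < j \<Longrightarrow> 2 * (r * j) \<le> n \<Longrightarrow>
       real (card {\<pi> \<in> partitions n. count \<pi> j < r}) \<le> 18 * ln n / sqrt n * real (r * j) * card (partitions n)"
    and few: "real (card {\<pi> \<in> partitions n. real (card (set_mset \<pi>)) \<le> sqrt n / (8 * ln n)}) \<le> 1 / n * card (partitions n)"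
    and big: "32 * real (R ^ (2 * L)) * (ln n) ^ 3 \<le> sqrt n"
    and ln2: "2 \<le> ln n" and R2: "2 \<le> R" and RL: "(ln n) ^ 8 \<le> real R" and L1: "1 \<le> L"
  shows "real (card {\<pi> \<in> partitions n. graphical \<pi>})
    \<le> ((39 / 40) ^ L + 100 * (36864 * L / (ln n) ^ 3) * L + 1 / ln n + 72 * L / ln n + 1 / n) * card (partitions n)"
proof -
  let ?T = "durfee_triples n"
  let ?p = "real (card (partitions n))"

  \<comment> \<open>Scales, windows and thresholds\<close>
  define \<eta> where "\<eta> = 36864 * L / (ln n) ^ 3"
  \<comment> \<open>The window \<open>{l i<..h i}\<close> reaches a factor \<open>R\<close> to
    either side of the scale \<open>k i\<close>. Since \<open>h i = l (i + 1)\<close>, the windows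
    are adjacent and disjoint.\<close>
  define k where "k = (\<lambda>i. R ^ (2 * i))"
  define l where "l = (\<lambda>i. R ^ (2 * i - 1))"
  define h where "h = (\<lambda>i. R ^ (2 * i + 1))"
  \<comment> \<open>This is a factor \<open>(ln n)\<^sup>2\<close> below the typical multiplicity
    \<open>sqrt n / k i\<close>. One such factor cancels the \<open>ln n\<close> in
    \<open>cnt\<close>, the other makes small multiplicities rare.\<close>
  define r where "r = (\<lambda>i. nat \<lfloor>sqrt n / (k i * (ln n)\<^sup>2)\<rfloor>)"
  \<comment> \<open>A Markov threshold: \<open>L * ln n\<close> times the bound
    \<open>1536 * n * k i / R\<close> on the mean variance outside the window, so that the
    \<open>L\<close> scales together cost only \<open>1 / ln n\<close>.\<close>
  define \<theta> where "\<theta> = (\<lambda>i. 1536 * L * ln n * n * k i / R)"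
  define s where "s = (\<lambda>(a :: nat \<Rightarrow> nat) (b :: nat \<Rightarrow> nat) j. a j + b j)"
  define far where "far = (\<lambda>i (D, a, b). block_var (k i) (s a b) ({1..D} - {l i<..h i}))"
  define nbad where "nbad = (\<lambda>i \<pi>. real (card {j \<in> {k i<..2 * k i}. count \<pi> j < r i}))"
  have n0: "0 < n" using ln2 by (cases n) auto
  have n1: "1 < real n" using ln2 n0 by (metis ln_gt_zero_iff less_le_trans of_nat_0_less_iff zero_less_numeral)
  have [simp]: "Suc 0 < n" "Suc 0 \<le> n" using n1 by simp_all
  have k0: "0 < k i" for i using R2 by (simp add: k_def)
  have kL: "k i \<le> R ^ (2 * L)" if "i \<in> {1..L}" for i
    using that R2 unfolding k_def by (intro power_increasing) auto
  have lk: "l i * R = k i" "l i < k i" if "i \<in> {1..L}" for i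
  proof -
    have "2 * i = Suc (2 * i - 1)" using that by auto
    then show "l i * R = k i" unfolding l_def k_def by (metis power_Suc2)
    show "l i < k i" unfolding l_def k_def using R2 that by (intro power_strict_increasing) auto
  qed
  have hk: "h i = k i * R" for i by (simp add: h_def k_def)
  have kbig: "32 * real (k i) * (ln n) ^ 3 \<le> sqrt n" if "i \<in> {1..L}" for i
  proof -
    have "32 * real (k i) * (ln n) ^ 3 \<le> 32 * real (R ^ (2 * L)) * (ln n) ^ 3"
      using kL[OF that] ln2 by (intro mult_right_mono mult_left_mono) (auto simp flip: of_nat_power)
    then show ?thesis using big by simp
  qed
  have x1: "1 \<le> sqrt n / (k i * (ln n)\<^sup>2)" if "i \<in> {1..L}" for i
  proof -
    have "real (k i) * (ln n)\<^sup>2 \<le> 32 * real (k i) * (ln n) ^ 3"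
    proof -
      have "(ln n)\<^sup>2 * 1 \<le> (ln n)\<^sup>2 * (32 * ln n)" using ln2 by (intro mult_left_mono) auto
      then have "real (k i) * (ln n)\<^sup>2 \<le> real (k i) * ((ln n)\<^sup>2 * (32 * ln n))"
        by (intro mult_left_mono) auto
      then show ?thesis by (simp add: power2_eq_square power3_eq_cube ac_simps)
    qed
    then have "real (k i) * (ln n)\<^sup>2 \<le> sqrt n" using kbig[OF that] by linarith
    moreover have "0 < real (k i) * (ln n)\<^sup>2" using k0[of i] ln2 by simp
    ultimately show ?thesis by (simp only: le_divide_eq_1_pos)
  qed
  have r_le: "real (r i) \<le> sqrt n / (k i * (ln n)\<^sup>2)" for i unfolding r_def by (simp add: of_nat_nat)
  have r_ge: "sqrt n / (2 * (k i * (ln n)\<^sup>2)) \<le> real (r i)" if "i \<in> {1..L}" for i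
  proof -
    let ?x = "sqrt n / (k i * (ln n)\<^sup>2)"
    have "?x / 2 \<le> real (r i)" unfolding r_def by (rule half_le_nat_floor[OF x1[OF that]])
    then show ?thesis by (simp add: ac_simps)
  qed

  \<comment> \<open>Triples with a large variance outside a window\<close>
  have bad_far: "real (card {t \<in> ?T. \<theta> i \<le> far i t}) \<le> ?p / (L * ln n)" if i: "i \<in> {1..L}" for i
  proof -
    define J where "J = nat \<lceil>sqrt n\<rceil>"
    have J: "sqrt n \<le> real J" "real J \<le> 2 * sqrt n"
    proof -
      have "1 \<le> sqrt n" using n1 by simp
      then show "sqrt n \<le> real J" "real J \<le> 2 * sqrt n" unfolding J_def by linarith+
    qed
    have "(sqrt n)\<^sup>2 \<le> (real J)\<^sup>2" using J by (intro power_mono) auto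
    then have J1: "n \<le> J\<^sup>2" by (simp flip: of_nat_power)
    have "(real J)\<^sup>2 \<le> (2 * sqrt n)\<^sup>2" using J by (intro power_mono) auto
    then have J2: "(real J)\<^sup>2 \<le> 4 * n" by (simp add: power_mult_distrib)
    have J0: "0 < J" using J1 n0 by (cases J) auto
    have "(\<Sum>t\<in>?T. far i t) \<le> 192 * real J ^ 2 * ?p * (real (l i) + (real (k i))\<^sup>2 / real (h i))"
      using sum_far_block_var_le[OF J1 J0, of "h i" "k i" "l i"] R2 unfolding far_def s_def
      by (simp add: h_def case_prod_beta)
    \<comment> \<open>Both sides of the window contribute the same amount
      \<open>k i / R\<close>.\<close>
    also have "real (l i) + (real (k i))\<^sup>2 / real (h i) = 2 * real (k i) / R"
      using lk(1)[OF i] k0[of i] R2 unfolding hk by (simp add: field_simps power2_eq_square flip: lk(1)[OF i])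
    also have "192 * real J ^ 2 * ?p * (2 * real (k i) / R) \<le> 192 * (4 * n) * ?p * (2 * real (k i) / R)"
      using J2 by (intro mult_right_mono mult_left_mono) auto
    also have "\<dots> = \<theta> i * (?p / (L * ln n))"
      using L1 ln2 unfolding \<theta>_def by (simp add: field_simps)
    finally have "(\<Sum>t\<in>?T. far i t) \<le> \<theta> i * (?p / (L * ln n))" .
    moreover have "0 < \<theta> i" using L1 ln2 n0 k0[of i] R2 unfolding \<theta>_def
      by (intro divide_pos_pos mult_pos_pos) auto
    moreover have "0 \<le> far i t" for t
      unfolding far_def block_var_def by (cases t) (auto intro!: sum_nonneg simp: unif_var_bounds)
    ultimately show ?thesis by (intro card_ge_markov finite_durfee_triples) auto
  qed

  \<comment> \<open>Triples with many small multiplicities near a scale\<close>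
  have bad_near: "real (card {t \<in> ?T. real (k i) / 2 \<le> nbad i (of_durfee t)}) \<le> 72 / ln n * ?p" if i: "i \<in> {1..L}" for i
  proof -
    have "(\<Sum>\<pi>\<in>partitions n. nbad i \<pi>) = (\<Sum>\<pi>\<in>partitions n. \<Sum>j\<in>{k i<..2 * k i}. of_bool (count \<pi> j < r i))"
      unfolding nbad_def by (intro sum.cong) (auto simp: Int_def)
    also have "\<dots> = (\<Sum>j\<in>{k i<..2 * k i}. \<Sum>\<pi>\<in>partitions n. of_bool (count \<pi> j < r i))"
      by (rule sum.swap)
    also have "\<dots> = (\<Sum>j\<in>{k i<..2 * k i}. real (card {\<pi> \<in> partitions n. count \<pi> j < r i}))"
      using finite_partitions by (intro sum.cong) (auto simp: Int_def)
    also have "\<dots> \<le> (\<Sum>j\<in>{k i<..2 * k i}. 36 / ln n * ?p)"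
    proof (intro sum_mono)
      fix j assume j: "j \<in> {k i<..2 * k i}"
      have "real (r i * j) \<le> sqrt n / (k i * (ln n)\<^sup>2) * (2 * k i)"
        using r_le[of i] j unfolding of_nat_mult by (intro mult_mono) auto
      also have "\<dots> = 2 * sqrt n / (ln n)\<^sup>2" using k0[of i] by simp
      finally have rj: "real (r i * j) \<le> 2 * sqrt n / (ln n)\<^sup>2" .
      also have "\<dots> \<le> 2 * sqrt n / 2\<^sup>2" using ln2 by (intro divide_left_mono power_mono) auto
      also have "\<dots> \<le> n / 2"
      proof -
        have "real n * 1 \<le> real n * real n" using n1 by (intro mult_left_mono) auto
        then have "sqrt n \<le> n" by (intro real_le_lsqrt) (simp_all add: power2_eq_square)
        then show ?thesis by simp
      qed
      finally have "real (2 * (r i * j)) \<le> real n" by simp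
      then have "2 * (r i * j) \<le> n" by linarith
      then have "real (card {\<pi> \<in> partitions n. count \<pi> j < r i}) \<le> 18 * ln n / sqrt n * real (r i * j) * ?p"
        using j by (intro cnt) auto
      also have "\<dots> \<le> 18 * ln n / sqrt n * (2 * sqrt n / (ln n)\<^sup>2) * ?p"
        using rj ln2 by (intro mult_right_mono mult_left_mono) auto
      also have "\<dots> = 36 / ln n * ?p" using n0 ln2 by (simp add: power2_eq_square field_simps)
      finally show "real (card {\<pi> \<in> partitions n. count \<pi> j < r i}) \<le> 36 / ln n * ?p" .
    qed
    \<comment> \<open>The sum is put in the form needed for Markov's inequality at level
      \<open>k i / 2\<close>, which doubles 36 to 72.\<close>
    also have "\<dots> = (real (k i) / 2) * (72 / ln n * ?p)" by simp
    finally have "real (card {\<pi> \<in> partitions n. real (k i) / 2 \<le> nbad i \<pi>}) \<le> 72 / ln n * ?p"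
      using k0[of i] finite_partitions by (intro card_ge_markov) (auto simp: nbad_def)
    then show ?thesis by (simp only: card_durfee_triples_of[where Q = "\<lambda>\<pi>. real (k i) / 2 \<le> nbad i \<pi>"])
  qed

  \<comment> \<open>Triples with a small Durfee square\<close>
  have bad_D: "real (card {(D, a, b) \<in> ?T. D \<le> 2 * R ^ (2 * L)}) \<le> 1 / n * ?p"
  proof -
    \<comment> \<open>A small square allows at most \<open>4 * R ^ (2 * L)\<close> distinct parts,
      and \<open>big\<close> places this below the threshold in \<open>few\<close>.\<close>
    have "{(D, a, b) \<in> ?T. D \<le> 2 * R ^ (2 * L)} \<subseteq> {t \<in> ?T. real (card (set_mset (of_durfee t))) \<le> sqrt n / (8 * ln n)}"
    proof clarify
      fix D a b assume D: "D \<le> 2 * R ^ (2 * L)"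
      have "card (set_mset (of_durfee (D, a, b))) \<le> 4 * R ^ (2 * L)"
        using card_set_of_durfee[of D a b] D by linarith
      then have "real (card (set_mset (of_durfee (D, a, b)))) \<le> 4 * real (R ^ (2 * L))" by linarith
      also have "\<dots> \<le> sqrt n / (8 * ln n)"
      proof -
        have "32 * real (R ^ (2 * L)) * ln n \<le> 32 * real (R ^ (2 * L)) * (ln n) ^ 3"
          using ln2 self_le_power[of "ln n" 3] by (intro mult_left_mono) auto
        then show ?thesis using big ln2 by (simp add: field_simps)
      qed
      finally show "real (card (set_mset (of_durfee (D, a, b)))) \<le> sqrt n / (8 * ln n)" .
    qed
    then have "card {(D, a, b) \<in> ?T. D \<le> 2 * R ^ (2 * L)}
        \<le> card {t \<in> ?T. real (card (set_mset (of_durfee t))) \<le> sqrt n / (8 * ln n)}"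
      by (intro card_mono) (auto simp: finite_durfee_triples)
    then show ?thesis
      using few card_durfee_triples_of[of n "\<lambda>\<pi>. real (card (set_mset \<pi>)) \<le> sqrt n / (8 * ln n)"] by linarith
  qed

  \<comment> \<open>Good triples\<close>
  define B where "B = (\<lambda>i D. {1..D} \<inter> {l i<..h i})"
  \<comment> \<open>Everything here is expressed by \<open>D\<close> and the sums \<open>s\<close>,
    as \<open>card_fibrewise_le\<close> requires.\<close>
  define good where "good = (\<lambda>D s. 2 * R ^ (2 * L) < D \<and> (\<forall>i\<in>{1..L}. 0 < block_var (k i) s (B i D) \<and>
      block_var (k i) s ({1..D} - {l i<..h i}) \<le> \<eta> * block_var (k i) s (B i D)))"
  \<comment> \<open>The necessary inequalities at the scales \<open>k i\<close>, rewritten with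
    \<open>b j - a j = s j - 2 * a j\<close>.\<close>
  define cond where "cond = (\<lambda>D s f. \<forall>i\<in>{1..L}. 0 \<le> (\<Sum>j=1..D. real (min j (k i)) * (real (s j) - 2 * real (f j :: nat))))"

  have not_good: "(\<exists>i\<in>{1..L}. \<theta> i \<le> far i (D, a, b)) \<or> (\<exists>i\<in>{1..L}. real (k i) / 2 \<le> nbad i (of_durfee (D, a, b)))
      \<or> D \<le> 2 * R ^ (2 * L)" if ng: "\<not> good D (s a b)" for D a b
  proof (rule ccontr)
    assume "\<not> ?thesis"
    then have f: "\<And>i. i \<in> {1..L} \<Longrightarrow> far i (D, a, b) < \<theta> i"
      and nb: "\<And>i. i \<in> {1..L} \<Longrightarrow> nbad i (of_durfee (D, a, b)) < real (k i) / 2"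
      and D: "2 * R ^ (2 * L) < D" by (auto simp: not_le)
    have "0 < block_var (k i) (s a b) (B i D) \<and>
       block_var (k i) (s a b) ({1..D} - {l i<..h i}) \<le> \<eta> * block_var (k i) (s a b) (B i D)" if i: "i \<in> {1..L}" for i
    proof -
      have kD: "2 * k i < D" using kL[OF i] D by linarith
      have "real (k i) * n / (24 * (ln n) ^ 4) = real (k i) ^ 3 * (sqrt n / (2 * (k i * (ln n)\<^sup>2)))\<^sup>2 / 6"
        using k0[of i] ln2 by (simp add: power_divide power_mult_distrib power3_eq_cube power2_eq_square power4_eq_xxxx field_simps)
      also have "\<dots> \<le> real (k i) ^ 3 * (real (r i))\<^sup>2 / 6"
        using r_ge[OF i] ln2 by (intro divide_right_mono mult_left_mono power_mono) auto
      also have "\<dots> \<le> block_var (k i) (s a b) {k i<..2 * k i}"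
        unfolding s_def using nb[OF i] kD unfolding nbad_def by (intro near_block_var_ge)
      also have "\<dots> \<le> block_var (k i) (s a b) (B i D)"
      proof (intro block_var_mono)
        have "2 * k i \<le> h i" unfolding hk using R2 by simp
        then show "{k i<..2 * k i} \<subseteq> B i D" using kD lk(2)[OF i] unfolding B_def by auto
      qed (simp add: B_def)
      finally have near: "real (k i) * n / (24 * (ln n) ^ 4) \<le> block_var (k i) (s a b) (B i D)" .
      have q0: "0 < real (k i) * n / (24 * (ln n) ^ 4)" using k0[of i] n0 ln2
        by (intro divide_pos_pos mult_pos_pos zero_less_power) auto
      have "block_var (k i) (s a b) ({1..D} - {l i<..h i}) \<le> \<theta> i"
        using f[OF i] by (simp add: far_def)
      \<comment> \<open>Of the eight powers of \<open>ln n\<close> gained from \<open>R\<close>,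
        four pay for the lower bound inside the window and one for the Markov threshold. The other
        three make \<open>\<eta>\<close> small.\<close>
      also have "\<dots> \<le> 1536 * L * ln n * n * k i / (ln n) ^ 8"
        unfolding \<theta>_def using RL ln2 R2 by (intro divide_left_mono mult_pos_pos) auto
      also have "\<dots> = \<eta> * (real (k i) * n / (24 * (ln n) ^ 4))"
        unfolding \<eta>_def of_nat_mult of_nat_numeral using ln2 by (intro scale_ratio_eq) auto
      also have "\<dots> \<le> \<eta> * block_var (k i) (s a b) (B i D)"
        using near ln2 by (intro mult_left_mono) (auto simp: \<eta>_def)
      finally show ?thesis using near q0 by linarith
    qed
    then show False using ng D by (auto simp: good_def)
  qed

  have disj: "disjoint_family_on (\<lambda>i. B i D) {1..L}" for D
  proof -
    have "{l i<..h i} \<inter> {l i'<..h i'} = {}" if "i < i'" for i i'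
    proof -
      have "h i \<le> l i'" unfolding h_def l_def using R2 that by (intro power_increasing) auto
      then show ?thesis by auto
    qed
    then have "{l i<..h i} \<inter> {l i'<..h i'} = {}" if "i \<noteq> i'" for i i'
      using that by (metis Int_commute nat_neq_iff)
    then show ?thesis unfolding disjoint_family_on_def B_def by blast
  qed

  have box: "measure_pmf.prob (box_pmf D s) {f. cond D s f} \<le> (39 / 40) ^ L + 100 * \<eta> * L" if g: "good D s" for D s
  proof -
    have sub: "{1..D} - B i D = {1..D} - {l i<..h i}" for i by (auto simp: B_def)
    have "measure_pmf.prob (box_pmf D s) {f. \<forall>i\<in>{1..L}. 0 \<le> (\<Sum>j=1..D. real (min j (k i)) * (real (s j) - 2 * real (f j)))}
        \<le> (39 / 40) ^ card {1..L} + 100 * \<eta> * card {1..L}"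
    proof (rule box_persistence[where B = "\<lambda>i. B i D"])
      fix i assume i: "i \<in> {1..L}"
      show "B i D \<subseteq> {1..D}" by (auto simp: B_def)
      show "0 < (\<Sum>j\<in>B i D. (real (min j (k i)))\<^sup>2 * unif_var (s j))"
        using g i unfolding good_def block_var_def by blast
      show "(\<Sum>j\<in>{1..D} - B i D. (real (min j (k i)))\<^sup>2 * unif_var (s j))
          \<le> \<eta> * (\<Sum>j\<in>B i D. (real (min j (k i)))\<^sup>2 * unif_var (s j))"
        using g i unfolding good_def block_var_def sub by blast
    qed (use disj in auto)
    then show ?thesis by (simp add: cond_def)
  qed

  have gr: "cond D (s a b) a" if "graphical (of_durfee (D, a, b))" "good D (s a b)" for D a b
    unfolding cond_def
  proof
    fix i assume i: "i \<in> {1..L}"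
    have "k i \<le> D" using kL[OF i] that(2) by (auto simp: good_def)
    then have "(\<Sum>j=1..D. min j (k i) * a j) \<le> (\<Sum>j=1..D. min j (k i) * b j)"
      by (rule graphical_of_durfee_imp[OF that(1)])
    then have "real (\<Sum>j=1..D. min j (k i) * a j) \<le> real (\<Sum>j=1..D. min j (k i) * b j)" by linarith
    then have "0 \<le> (\<Sum>j=1..D. real (min j (k i)) * real (b j) - real (min j (k i)) * real (a j))"
      unfolding sum_subtractf by simp
    also have "\<dots> = (\<Sum>j=1..D. real (min j (k i)) * (real (s a b j) - 2 * real (a j)))"
      by (intro sum.cong) (auto simp: s_def algebra_simps)
    finally show "0 \<le> (\<Sum>j=1..D. real (min j (k i)) * (real (s a b j) - 2 * real (a j)))" .
  qed

  \<comment> \<open>Union bound over good triples and exceptional sets\<close>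
  let ?G = "{(D, a, b) \<in> ?T. good D (\<lambda>j. a j + b j) \<and> cond D (\<lambda>j. a j + b j) a}"
  let ?F = "\<Union>i\<in>{1..L}. {t \<in> ?T. \<theta> i \<le> far i t}"
  let ?N = "\<Union>i\<in>{1..L}. {t \<in> ?T. real (k i) / 2 \<le> nbad i (of_durfee t)}"
  let ?S = "{(D, a, b) \<in> ?T. D \<le> 2 * R ^ (2 * L)}"
  have fin: "finite ?G" "finite ?F" "finite ?N" "finite ?S"
    by (rule finite_subset[OF _ finite_durfee_triples[of n]]; auto)+
  have "{t \<in> ?T. graphical (of_durfee t)} \<subseteq> ?G \<union> ?F \<union> ?N \<union> ?S"
  proof
    fix t assume "t \<in> {t \<in> ?T. graphical (of_durfee t)}"
    moreover obtain D a b where t: "t = (D, a, b)" by (cases t)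
    ultimately have g: "(D, a, b) \<in> ?T" "graphical (of_durfee (D, a, b))" by auto
    show "t \<in> ?G \<union> ?F \<union> ?N \<union> ?S"
    proof (cases "good D (s a b)")
      case True
      then have "t \<in> ?G" using gr[OF g(2) True] g(1) t by (simp add: s_def)
      then show ?thesis by blast
    next
      case False
      then show ?thesis using not_good[OF False] g(1) t by blast
    qed
  qed
  then have "card {t \<in> ?T. graphical (of_durfee t)} \<le> card (?G \<union> ?F \<union> ?N \<union> ?S)"
    using fin by (intro card_mono) auto
  also have "\<dots> \<le> card ?G + card ?F + card ?N + card ?S"
    by (meson add_le_mono card_Un_le le_refl le_trans)
  finally have "real (card {\<pi> \<in> partitions n. graphical \<pi>}) \<le> real (card ?G) + real (card ?F) + real (card ?N) + real (card ?S)"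
    unfolding card_durfee_triples_of[of n graphical] by linarith
  also have "real (card ?G) \<le> ((39 / 40) ^ L + 100 * \<eta> * L) * card ?T"
    using ln2 by (intro card_fibrewise_le box) (auto simp: \<eta>_def)
  also have "real (card ?T) = ?p" using bij_betw_same_card[OF bij_betw_of_durfee] by simp
  also have "real (card ?F) \<le> (\<Sum>i\<in>{1..L}. real (card {t \<in> ?T. \<theta> i \<le> far i t}))"
    unfolding of_nat_sum[symmetric] of_nat_le_iff by (rule card_UN_le) simp
  also have "\<dots> \<le> (\<Sum>i\<in>{1..L}. ?p / (L * ln n))" by (intro sum_mono bad_far)
  also have "\<dots> = 1 / ln n * ?p" using L1 by simp
  also have "real (card ?N) \<le> (\<Sum>i\<in>{1..L}. real (card {t \<in> ?T. real (k i) / 2 \<le> nbad i (of_durfee t)}))"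
    unfolding of_nat_sum[symmetric] of_nat_le_iff by (rule card_UN_le) simp
  also have "\<dots> \<le> (\<Sum>i\<in>{1..L}. 72 / ln n * ?p)" by (intro sum_mono bad_near)
  also have "\<dots> = 72 * L / ln n * ?p" by simp
  also have "real (card ?S) \<le> 1 / n * ?p" by (rule bad_D)
  finally show ?thesis unfolding \<eta>_def by (simp add: algebra_simps)
qed

theorem theorem4:
  "(\<lambda>n::nat. measure_pmf.prob (pmf_of_set (partitions n)) {p. graphical p})
     \<in> O[inf at_top (principal {n. even n})](\<lambda>n. 1 / ln (real n) powr (1 / 2))"
proof -
  \<comment> \<open>The factor 20 is chosen so that
    \<open>(39 / 40) ^ L n \<le> exp (- (L n / 40))\<close> is at most
    \<open>1 / ln n powr (1 / 2)\<close>.\<close>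
  define L where "L = (\<lambda>n::nat. nat \<lceil>20 * ln (ln n)\<rceil>)"
  define R where "R = (\<lambda>n::nat. nat \<lceil>(ln n) ^ 8\<rceil>)"
  \<comment> \<open>The exponential dominates \<open>R n ^ (2 * L n)\<close>. Its exponent has order
    \<open>(ln (ln n))\<^sup>2\<close>, so it grows more slowly than any positive power of
    \<open>n\<close>.\<close>
  have e1: "eventually (\<lambda>n::nat. 32 * exp ((40 * ln (ln n) + 2) * ln ((ln n) ^ 8 + 1)) * (ln n) ^ 3 \<le> sqrt n) at_top"
    by real_asymp
  \<comment> \<open>All these error terms are \<open>1 / ln n\<close> up to powers of
    \<open>ln (ln n)\<close>, or smaller, hence eventually below
    \<open>1 / ln n powr (1 / 2)\<close>.\<close>
  have e2: "eventually (\<lambda>n::nat. 100 * (36864 * (20 * ln (ln n) + 1) / (ln n) ^ 3) * (20 * ln (ln n) + 1)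
      + 1 / ln n + 72 * (20 * ln (ln n) + 1) / ln n + 1 / n \<le> 1 / ln n powr (1 / 2)) at_top"
    by real_asymp
  have e3: "eventually (\<lambda>n::nat. 3 \<le> ln n) at_top" by real_asymp
  have "eventually (\<lambda>n::nat. measure_pmf.prob (pmf_of_set (partitions n)) {p. graphical p} \<le> 2 * (1 / ln n powr (1 / 2))) at_top"
    using partitions_count_less_ratio card_partitions_few_distinct_ratio e1 e2 e3
  proof eventually_elim
    case (elim n)
    let ?p = "real (card (partitions n))"
    have "ln 3 \<le> ln (ln (real n))" using elim by (subst ln_le_cancel_iff) auto
    moreover have "1 \<le> ln (3::real)" using exp_le by (subst ln_ge_iff) auto
    ultimately have ll: "1 \<le> ln (ln (real n))" by linarith
    have L: "20 * ln (ln n) \<le> L n" "L n \<le> 20 * ln (ln n) + 1" "1 \<le> L n" unfolding L_def using ll by linarith+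
    have "3 ^ 8 \<le> (ln n) ^ 8" using elim by (intro power_mono) auto
    then have ln8: "1 < (ln n) ^ 8" by simp
    have R: "(ln n) ^ 8 \<le> R n" "R n \<le> (ln n) ^ 8 + 1" "2 \<le> R n" unfolding R_def using ln8 by linarith+
    have "exp (ln (real (R n))) = real (R n)" using R by simp
    then have "real (R n ^ (2 * L n)) = exp (real (2 * L n) * ln (R n))"
      by (simp only: exp_of_nat_mult of_nat_power)
    also have "\<dots> \<le> exp ((40 * ln (ln n) + 2) * ln ((ln n) ^ 8 + 1))"
      using L R ll by (subst exp_le_cancel_iff, intro mult_mono) auto
    finally have "32 * real (R n ^ (2 * L n)) * (ln n) ^ 3 \<le> 32 * exp ((40 * ln (ln n) + 2) * ln ((ln n) ^ 8 + 1)) * (ln n) ^ 3"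
      using elim by (intro mult_right_mono mult_left_mono) auto
    then have big: "32 * real (R n ^ (2 * L n)) * (ln n) ^ 3 \<le> sqrt n" using elim by linarith
    have "measure_pmf.prob (pmf_of_set (partitions n)) {p. graphical p} = real (card {\<pi> \<in> partitions n. graphical \<pi>}) / ?p"
      using finite_partitions partitions_nonempty by (simp add: measure_pmf_of_set Int_def)
    also have "\<dots> \<le> (39 / 40) ^ L n + 100 * (36864 * L n / (ln n) ^ 3) * L n + 1 / ln n + 72 * L n / ln n + 1 / n"
      using card_graphical_le[of n "R n" "L n"] elim big L R card_partitions_pos[of n]
      by (simp add: divide_le_eq)
    also have "\<dots> \<le> 1 / ln n powr (1 / 2) + 100 * (36864 * (20 * ln (ln n) + 1) / (ln n) ^ 3) * (20 * ln (ln n) + 1)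
        + 1 / ln n + 72 * (20 * ln (ln n) + 1) / ln n + 1 / n"
    proof (intro add_mono mult_mono divide_right_mono order_refl)
      have "(39 / 40 :: real) ^ L n \<le> exp (- 1 / 40) ^ L n"
        using exp_ge_add_one_self[of "- 1 / 40 :: real"] by (intro power_mono) auto
      also have "\<dots> = exp (- (L n / 40))" by (simp flip: exp_of_nat_mult)
      also have "\<dots> \<le> exp (- (1 / 2 * ln (ln n)))" using L by simp
      also have "\<dots> = 1 / ln n powr (1 / 2)" using elim by (simp add: powr_def exp_minus field_simps)
      finally show "(39 / 40) ^ L n \<le> 1 / ln n powr (1 / 2)" .
    qed (use L ll elim in auto)
    also have "\<dots> \<le> 1 / ln n powr (1 / 2) + 1 / ln n powr (1 / 2)" using elim by linarith
    finally show ?case by simp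
  qed
  then have "eventually (\<lambda>n::nat. norm (measure_pmf.prob (pmf_of_set (partitions n)) {p. graphical p})
      \<le> 2 * norm (1 / ln n powr (1 / 2))) at_top"
    by eventually_elim simp
  then have "eventually (\<lambda>n::nat. norm (measure_pmf.prob (pmf_of_set (partitions n)) {p. graphical p})
      \<le> 2 * norm (1 / ln n powr (1 / 2))) (inf at_top (principal {n. even n}))"
    by (rule filter_leD[OF inf_le1])
  then show ?thesis by (rule bigoI)
qed

end
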